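(* Let $H$ be a complex Hilbert space, let $\mathcal{E}$ be a totally ordered complete family of partial isometries on $H$, and let $$\mathcal{A}_{\mathcal{E}}=\{T\in B(H)\colon (I-Q_E)TP_E=0\text{ for all }E\in\mathcal{E}\}$$ be a $2$-nest algebra, i.e. suppose that $\mathcal{A}_{\mathcal{E}}$ is a subalgebra of $B(H)$. Let $\mathcal{R}_1$ be the set of finite rank operators in the closed unit ball of $\mathcal{A}_{\mathcal{E}}$. Then the closure of $\mathcal{R}_1$ in the strong operator topology coincides with the closed unit ball of $\mathcal{A}_{\mathcal{E}}$.
   Context: $B(H)$ is the set of bounded linear operators on $H$ and $I$ is the identity operator. A partial isometry is $V\in B(H)$ with $\|Vx\|=\|x\|$ for all $x\in\ker(V)^\perp$; its initial space is $\ker(V)^\perp$ and its final space is $\operatorname{ran}(V)$. $P_V=V^*V$ and $Q_V=VV^*$ are the orthogonal projections onto the initial and final spaces. Partial isometries are ordered by the Halmos--McLaughlin ordering: $E\le F$ if $F(x)=E(x)$ for all $x$ in the initial space of $E$ (so that the initial space of $E$ is contained in that of $F$). A family of partial isometries is complete if it contains $0$ and, for every nonempty subset of it, the supremum and infimum (in the poset of all partial isometries on $H$) exist and lie in the family. The closed unit ball of $\mathcal{A}_{\mathcal{E}}$ is $\{T\in\mathcal{A}_{\mathcal{E}}\colon\|T\|\le 1\}$ for the operator norm. *)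

theory Defs
  imports "HOL-Analysis.Analysis"
begin

text \<open>
  The underlying real inner product is the real part of the complex one, so that the norm,
  the metric and the topology are those of the library.  The complex inner product is linear in
  its first argument.
\<close>

class complex_hilbert_space = real_inner + complete_space +
  fixes scaleC :: "complex \<Rightarrow> 'a \<Rightarrow> 'a" (infixr \<open>*\<^sub>C\<close> 75)
    and cinner :: "'a \<Rightarrow> 'a \<Rightarrow> complex"
  assumes scaleC_add_right: "c *\<^sub>C (x + y) = c *\<^sub>C x + c *\<^sub>C y"
    and scaleC_add_left: "(c + d) *\<^sub>C x = c *\<^sub>C x + d *\<^sub>C x"
    and scaleC_scaleC: "c *\<^sub>C d *\<^sub>C x = (c * d) *\<^sub>C x"
    and scaleC_of_real: "complex_of_real r *\<^sub>C x = r *\<^sub>R x"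
    and cinner_add_left: "cinner (x + y) z = cinner x z + cinner y z"
    and cinner_scaleC_left: "cinner (c *\<^sub>C x) y = c * cinner x y"
    and cinner_commute: "cinner x y = cnj (cinner y x)"
    and Re_cinner: "Re (cinner x y) = inner x y"

instantiation complex :: complex_hilbert_space
begin

definition scaleC_complex :: "complex \<Rightarrow> complex \<Rightarrow> complex"
  where "scaleC_complex c x = c * x"

definition cinner_complex :: "complex \<Rightarrow> complex \<Rightarrow> complex"
  where "cinner_complex x y = x * cnj y"

instance
  by standard
    (auto simp: scaleC_complex_def cinner_complex_def algebra_simps scaleR_conv_of_real
      inner_complex_def)

end

global_interpretation cvec: vector_space "scaleC :: complex \<Rightarrow> 'a \<Rightarrow> 'a::complex_hilbert_space"
proof
  show "1 *\<^sub>C x = x" for x :: 'a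
    using scaleC_of_real[of 1 x] by simp
qed (simp_all add: scaleC_add_right scaleC_add_left scaleC_scaleC)

lemma cinner_scaleC_right: "cinner x (c *\<^sub>C y) = cnj c * cinner x y"
proof -
  have "cinner x (c *\<^sub>C y) = cnj (cinner (c *\<^sub>C y) x)"
    by (rule cinner_commute)
  also have "\<dots> = cnj c * cnj (cinner y x)"
    by (simp add: cinner_scaleC_left)
  also have "cnj (cinner y x) = cinner x y"
    by (rule cinner_commute[symmetric])
  finally show ?thesis .
qed

lemma Im_cinner: "Im (cinner x y) = - inner (\<i> *\<^sub>C x) y"
  using Re_cinner[of "\<i> *\<^sub>C x" y] unfolding cinner_scaleC_left by simp

lemma cinner_eqI: "x = y" if "\<And>z. cinner z x = cinner z y"
proof -
  have "inner z x = inner z y" for z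
    using arg_cong[OF that[of z], of Re] by (simp add: Re_cinner)
  then show ?thesis
    using vector_eq_ldot by blast
qed

lemma cinner_self: "cinner x x = complex_of_real ((norm x)\<^sup>2)"
proof -
  have "Im (cinner x x) = 0"
    using arg_cong[OF cinner_commute[of x x], of Im] by simp
  then show ?thesis
    by (simp add: complex_eq_iff Re_cinner power2_norm_eq_inner)
qed

lemma norm_scaleC: "norm (c *\<^sub>C x) = cmod c * norm x"
proof -
  have "cinner (c *\<^sub>C x) (c *\<^sub>C x) = (c * cnj c) * cinner x x"
    by (simp add: cinner_scaleC_left cinner_scaleC_right)
  also have "\<dots> = complex_of_real ((cmod c * norm x)\<^sup>2)"
    unfolding complex_norm_square[symmetric] cinner_self
    by (simp add: power_mult_distrib)
  finally have "(norm (c *\<^sub>C x))\<^sup>2 = (cmod c * norm x)\<^sup>2"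
    by (metis cinner_self of_real_eq_iff)
  then show ?thesis
    by (simp add: power2_eq_iff_nonneg)
qed

lemma bounded_linear_scaleC: "bounded_linear (\<lambda>x::'a::complex_hilbert_space. c *\<^sub>C x)"
proof
  show "c *\<^sub>C r *\<^sub>R x = r *\<^sub>R c *\<^sub>C x" for r and x :: 'a
    by (simp flip: scaleC_of_real add: mult.commute)
  show "\<exists>K. \<forall>x::'a. norm (c *\<^sub>C x) \<le> norm x * K"
    by (metis norm_scaleC mult.commute order_refl)
qed (simp add: scaleC_add_right)

lemma Riesz_representation_real:
  fixes f :: "'a::{real_inner, complete_space} \<Rightarrow> real"
  assumes f: "bounded_linear f"
  obtains z where "\<And>x. f x = inner x z"
proof -
  interpret f: bounded_linear f by (fact f)
  define g where "g x = (norm x)\<^sup>2 / 2 - f x" for x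
  obtain K where K: "\<And>x. norm (f x) \<le> norm x * K"
    using f.bounded by blast
  have lb: "g x \<ge> - K\<^sup>2 / 2" for x
  proof -
    have "f x \<le> norm x * K" using K[of x] by simp
    moreover have "0 \<le> (norm x - K)\<^sup>2" by simp
    ultimately show ?thesis
      unfolding g_def by (simp add: power2_diff)
  qed
  define m where "m = Inf (range g)"
  have bdd: "bdd_below (range g)" using lb by (auto intro!: bdd_belowI)
  have m_le: "m \<le> g x" for x
    unfolding m_def using bdd by (auto intro: cInf_lower)
  have "\<exists>x. g x < m + inverse (real (Suc n))" for n
    using cInf_lessD[of "range g" "m + inverse (real (Suc n))"] by (auto simp: m_def)
  then obtain u where u: "\<And>n. g (u n) < m + inverse (real (Suc n))" by metis
  have par: "(norm (x - y))\<^sup>2 / 4 \<le> g x + g y - 2 * m" for x y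
  proof -
    have "(norm (x - y))\<^sup>2 / 4 = g x + g y - 2 * g ((1/2) *\<^sub>R (x + y))"
      unfolding g_def power2_norm_eq_inner f.scaleR f.add
      by (simp add: inner_simps inner_commute[of y x] field_simps)
    then show ?thesis using m_le[of "(1/2) *\<^sub>R (x + y)"] by simp
  qed
  have "Cauchy u"
  proof (rule metric_CauchyI)
    fix e :: real assume "e > 0"
    then obtain N where N: "inverse (real (Suc N)) < e\<^sup>2 / 8"
      using reals_Archimedean[of "e\<^sup>2 / 8"] by auto
    have "dist (u i) (u j) < e" if "i \<ge> N" "j \<ge> N" for i j
    proof -
      have "inverse (real (Suc i)) \<le> inverse (real (Suc N))"
        "inverse (real (Suc j)) \<le> inverse (real (Suc N))"
        using that by (auto intro!: le_imp_inverse_le)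
      then have "(norm (u i - u j))\<^sup>2 < e\<^sup>2"
        using par[of "u i" "u j"] u[of i] u[of j] N by linarith
      then show ?thesis
        using \<open>e > 0\<close> by (simp add: dist_norm power2_less_imp_less)
    qed
    then show "\<exists>M. \<forall>i\<ge>M. \<forall>j\<ge>M. dist (u i) (u j) < e" by blast
  qed
  then obtain z where z: "u \<longlonglongrightarrow> z"
    using Cauchy_convergent convergent_def by blast
  have "(\<lambda>n. g (u n)) \<longlonglongrightarrow> g z"
    unfolding g_def by (intro tendsto_intros z f.tendsto) simp
  moreover have "(\<lambda>n. m + inverse (real (Suc n))) \<longlonglongrightarrow> m + 0"
    by (intro tendsto_intros LIMSEQ_inverse_real_of_nat)
  ultimately have "g z \<le> m + 0"
    by (rule LIMSEQ_le) (meson u less_imp_le)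
  then have min: "g z \<le> g y" for y using m_le[of y] by simp
  have "f x = inner x z" for x
  proof -
    define a where "a = inner x z - f x"
    define b where "b = inner x x"
    have *: "0 \<le> t * a + t\<^sup>2 * b / 2" for t
    proof -
      have "g (z + t *\<^sub>R x) = g z + (t * a + t\<^sup>2 * b / 2)"
        unfolding g_def power2_norm_eq_inner f.scaleR f.add a_def b_def
        by (simp add: inner_simps inner_commute[of z x] field_simps power2_eq_square)
      then show ?thesis using min[of "z + t *\<^sub>R x"] by simp
    qed
    have "b \<ge> 0" by (simp add: b_def)
    have "0 \<le> (- a / (b + 1)) * a + (- a / (b + 1))\<^sup>2 * b / 2" by (rule *)
    also have "\<dots> = - (a\<^sup>2 * (b + 2)) / (2 * (b + 1)\<^sup>2)"
      using \<open>b \<ge> 0\<close> by (simp add: divide_simps) (simp add: algebra_simps power2_eq_square)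
    finally have "a\<^sup>2 * (b + 2) \<le> 0"
      using \<open>b \<ge> 0\<close> by (simp add: divide_simps split: if_splits)
    then have "a = 0"
      using \<open>b \<ge> 0\<close> by (smt (verit) mult_pos_pos zero_less_power2)
    then show ?thesis by (simp add: a_def)
  qed
  then show thesis by (rule that)
qed

text \<open>
  The type of bounded linear functions contains all bounded real-linear operators; the members of
  \<open>BH\<close> are the complex-linear ones.  Norm, sum and composition of operators are those of the
  library.
\<close>

definition BH :: "('h::complex_hilbert_space \<Rightarrow>\<^sub>L 'h) set"
  where "BH = {T. \<forall>c x. blinfun_apply T (c *\<^sub>C x) = c *\<^sub>C blinfun_apply T x}"

lift_definition op_scaleC ::
    "complex \<Rightarrow> ('h::complex_hilbert_space \<Rightarrow>\<^sub>L 'h) \<Rightarrow> ('h \<Rightarrow>\<^sub>L 'h)"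
  is "\<lambda>c T x. c *\<^sub>C T x"
  by (rule bounded_linear_compose[OF bounded_linear_scaleC])

definition is_adjoint ::
    "('h::complex_hilbert_space \<Rightarrow>\<^sub>L 'h) \<Rightarrow> ('h \<Rightarrow>\<^sub>L 'h) \<Rightarrow> bool"
  where "is_adjoint T S \<longleftrightarrow> S \<in> BH \<and>
    (\<forall>x y. cinner (blinfun_apply T x) y = cinner x (blinfun_apply S y))"

definition adj :: "('h::complex_hilbert_space \<Rightarrow>\<^sub>L 'h) \<Rightarrow> ('h \<Rightarrow>\<^sub>L 'h)"
  where "adj T = (THE S. is_adjoint T S)"

lemma ex1_adjoint:
  fixes T :: "'h::complex_hilbert_space \<Rightarrow>\<^sub>L 'h"
  assumes T: "T \<in> BH"
  shows "\<exists>!S. is_adjoint T S"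
proof (rule ex_ex1I)
  have "\<exists>z. \<forall>x. inner (blinfun_apply T x) y = inner x z" for y
  proof -
    have "bounded_linear (\<lambda>x. inner (blinfun_apply T x) y)"
      by (intro bounded_linear_intros)
    then show ?thesis by (metis Riesz_representation_real)
  qed
  then obtain S where S: "\<And>x y. inner (blinfun_apply T x) y = inner x (S y)" by metis
  have C: "cinner (blinfun_apply T x) y = cinner x (S y)" for x y
  proof (rule complex_eqI)
    show "Re (cinner (blinfun_apply T x) y) = Re (cinner x (S y))"
      by (simp add: Re_cinner S)
    have "\<i> *\<^sub>C blinfun_apply T x = blinfun_apply T (\<i> *\<^sub>C x)"
      using T by (simp add: BH_def)
    then show "Im (cinner (blinfun_apply T x) y) = Im (cinner x (S y))"
      by (simp add: Im_cinner S)
  qed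
  have scale: "S (c *\<^sub>C y) = c *\<^sub>C S y" for c y
    by (rule cinner_eqI) (simp add: cinner_scaleC_right flip: C)
  have "bounded_linear S"
  proof
    show "S (x + y) = S x + S y" for x y
      by (rule vector_eq_ldot[THEN iffD1]) (simp add: inner_simps flip: S)
    show "S (r *\<^sub>R x) = r *\<^sub>R S x" for r x
      by (simp add: scale flip: scaleC_of_real)
    have "norm (S y) \<le> norm y * norm T" for y
    proof (cases "S y = 0")
      case False
      have "norm (S y) * norm (S y) = inner (blinfun_apply T (S y)) y"
        by (simp add: S flip: power2_norm_eq_inner power2_eq_square)
      also have "\<dots> \<le> norm (blinfun_apply T (S y)) * norm y"
        by (rule norm_cauchy_schwarz)
      also have "\<dots> \<le> (norm T * norm (S y)) * norm y"
        by (intro mult_right_mono norm_blinfun) simp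
      finally show ?thesis using False by (simp add: mult_ac)
    qed simp
    then show "\<exists>K. \<forall>x. norm (S x) \<le> norm x * K" by blast
  qed
  then have "is_adjoint T (Blinfun S)"
    by (simp add: is_adjoint_def BH_def bounded_linear_Blinfun_apply scale C)
  then show "\<exists>S. is_adjoint T S" ..
next
  show "R = S" if "is_adjoint T R" "is_adjoint T S" for R S
  proof (rule blinfun_eqI, rule cinner_eqI)
    show "cinner z (blinfun_apply R y) = cinner z (blinfun_apply S y)" for y z
      using that unfolding is_adjoint_def by metis
  qed
qed

text \<open>Subalgebras are not required to contain the identity.\<close>

definition is_subalgebra :: "('h::complex_hilbert_space \<Rightarrow>\<^sub>L 'h) set \<Rightarrow> bool"
  where "is_subalgebra A \<longleftrightarrow> A \<subseteq> BH \<and> 0 \<in> A \<and>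
    (\<forall>S\<in>A. \<forall>T\<in>A. S + T \<in> A \<and> S o\<^sub>L T \<in> A) \<and>
    (\<forall>c. \<forall>T\<in>A. op_scaleC c T \<in> A)"

definition finite_rank :: "('h::complex_hilbert_space \<Rightarrow>\<^sub>L 'h) \<Rightarrow> bool"
  where "finite_rank T \<longleftrightarrow> (\<exists>B. finite B \<and> range (blinfun_apply T) \<subseteq> cvec.span B)"

definition BH_SOT :: "('h::complex_hilbert_space \<Rightarrow>\<^sub>L 'h) topology"
  where "BH_SOT = subtopology strong_operator_topology BH"

definition initial_space :: "('h::complex_hilbert_space \<Rightarrow>\<^sub>L 'h) \<Rightarrow> 'h set"
  where "initial_space V = {x. \<forall>y. blinfun_apply V y = 0 \<longrightarrow> cinner x y = 0}"

definition partial_isometry :: "('h::complex_hilbert_space \<Rightarrow>\<^sub>L 'h) \<Rightarrow> bool"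
  where "partial_isometry V \<longleftrightarrow>
    V \<in> BH \<and> (\<forall>x\<in>initial_space V. norm (blinfun_apply V x) = norm x)"

definition init_proj :: "('h::complex_hilbert_space \<Rightarrow>\<^sub>L 'h) \<Rightarrow> ('h \<Rightarrow>\<^sub>L 'h)"
  where "init_proj V = adj V o\<^sub>L V"

definition final_proj :: "('h::complex_hilbert_space \<Rightarrow>\<^sub>L 'h) \<Rightarrow> ('h \<Rightarrow>\<^sub>L 'h)"
  where "final_proj V = V o\<^sub>L adj V"

text \<open>
  The Halmos--McLaughlin ordering.  For partial isometries it forces the initial space of \<open>E\<close>
  to be contained in that of \<open>F\<close>.  Suprema and infima below are taken in the poset of all
  partial isometries, not in the given family.
\<close>

definition pi_le ::
    "('h::complex_hilbert_space \<Rightarrow>\<^sub>L 'h) \<Rightarrow> ('h \<Rightarrow>\<^sub>L 'h) \<Rightarrow> bool"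
  where "pi_le E F \<longleftrightarrow> (\<forall>x\<in>initial_space E. blinfun_apply F x = blinfun_apply E x)"

definition is_pi_sup ::
    "('h::complex_hilbert_space \<Rightarrow>\<^sub>L 'h) set \<Rightarrow> ('h \<Rightarrow>\<^sub>L 'h) \<Rightarrow> bool"
  where "is_pi_sup S V \<longleftrightarrow> partial_isometry V \<and> (\<forall>E\<in>S. pi_le E V) \<and>
    (\<forall>W. partial_isometry W \<and> (\<forall>E\<in>S. pi_le E W) \<longrightarrow> pi_le V W)"

definition is_pi_inf ::
    "('h::complex_hilbert_space \<Rightarrow>\<^sub>L 'h) set \<Rightarrow> ('h \<Rightarrow>\<^sub>L 'h) \<Rightarrow> bool"
  where "is_pi_inf S V \<longleftrightarrow> partial_isometry V \<and> (\<forall>E\<in>S. pi_le V E) \<and>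
    (\<forall>W. partial_isometry W \<and> (\<forall>E\<in>S. pi_le W E) \<longrightarrow> pi_le W V)"

definition complete_family :: "('h::complex_hilbert_space \<Rightarrow>\<^sub>L 'h) set \<Rightarrow> bool"
  where "complete_family \<E> \<longleftrightarrow> (\<forall>E\<in>\<E>. partial_isometry E) \<and> 0 \<in> \<E> \<and>
    (\<forall>S. S \<subseteq> \<E> \<and> S \<noteq> {} \<longrightarrow> (\<exists>V\<in>\<E>. is_pi_sup S V) \<and> (\<exists>V\<in>\<E>. is_pi_inf S V))"

definition totally_ordered :: "('h::complex_hilbert_space \<Rightarrow>\<^sub>L 'h) set \<Rightarrow> bool"
  where "totally_ordered \<E> \<longleftrightarrow> (\<forall>E\<in>\<E>. \<forall>F\<in>\<E>. pi_le E F \<or> pi_le F E)"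

definition family_ops ::
    "('h::complex_hilbert_space \<Rightarrow>\<^sub>L 'h) set \<Rightarrow> ('h \<Rightarrow>\<^sub>L 'h) set"
  where "family_ops \<E> =
    {T \<in> BH. \<forall>E\<in>\<E>. (id_blinfun - final_proj E) o\<^sub>L T o\<^sub>L init_proj E = 0}"

definition closed_unit_ball ::
    "('h::complex_hilbert_space \<Rightarrow>\<^sub>L 'h) set \<Rightarrow> ('h \<Rightarrow>\<^sub>L 'h) set"
  where "closed_unit_ball A = {T \<in> A. norm T \<le> 1}"

end

theory Submission
  imports Defs
begin

text \<open>
  An operator \<open>T\<close> belongs to \<open>family_ops \<E>\<close> exactly when it maps the initial space of every
  \<open>E \<in> \<E>\<close> into the final space of \<open>E\<close>.  Hence \<open>T F\<close> belongs to it as soon as \<open>T\<close> does and \<open>F\<close>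
  leaves all initial spaces invariant.  The initial spaces form a chain, so it suffices to find,
  for a chain of closed subspaces, finite-rank contractions that leave its members invariant and
  tend strongly to the identity: \<open>T F\<close> then has finite rank, norm at most \<open>1\<close>, and tends to \<open>T\<close>.
  That is Erdos's density theorem for nest algebras.

  For the density theorem, enlarge the chain to a maximal one, \<open>\<N>\<close>, and write \<open>P\<^sub>M\<close> for the
  projection onto \<open>M \<in> \<N>\<close>.  A vector \<open>z\<close> generates the cyclic subspace spanned by the \<open>P\<^sub>M z\<close>,
  and \<open>M \<mapsto> \<parallel>P\<^sub>M z\<parallel>\<^sup>2\<close> is the distribution function of its spectral measure.  The space
  is spanned by mutually orthogonal cyclic subspaces whose generators are of two kinds
  (\<open>total_cyclic_family\<close>), because any vector is either diffuse or has a nonzero atomic part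
  (\<open>diffuse_or_atomic_part\<close>):

  \<^item> If \<open>z\<close> lies in a single atom, its cyclic subspace is a line and the projection onto that line
    leaves every \<open>M\<close> invariant.

  \<^item> If \<open>\<parallel>P\<^sub>M z\<parallel>\<^sup>2\<close> takes every intermediate value, cut \<open>z\<close> along the chain into \<open>k\<close>
    consecutive blocks of equal norm and let \<open>e\<^sub>0, \<dots>, e\<^sub>k\<^sub>-\<^sub>1\<close> be the normalised blocks.  The
    partial isometry that sends each \<open>e\<^sub>i\<^sub>+\<^sub>1\<close> to \<open>e\<^sub>i\<close> only moves vectors down the chain, so it
    leaves every \<open>M\<close> invariant; as in the shift by \<open>1/k\<close> on an interval, it moves the vectors
    \<open>P\<^sub>M z\<close> very little when \<open>k\<close> is large (\<open>diffuse_approximating_frame\<close>).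

  Finitely many such operators have orthogonal supports and ranges, so their sum is
  again a contraction, and a net of these sums tends strongly to the identity
  (\<open>finite_rank_approximate_identity\<close>).
\<close>

section \<open>The complex inner product\<close>

lemma cinner_add_right: "cinner x (y + z) = cinner x y + cinner x z"
  by (metis cinner_add_left cinner_commute complex_cnj_add)

lemma cinner_zero_left [simp]: "cinner 0 y = 0"
  using cinner_scaleC_left[of 0 y y] by simp

lemma cinner_zero_right [simp]: "cinner x 0 = 0"
  using cinner_scaleC_right[of x 0 x] by simp

lemma cinner_minus_left [simp]: "cinner (- x) y = - cinner x y"
  using cinner_add_left[of "- x" x y] by (simp add: eq_neg_iff_add_eq_0)

lemma cinner_minus_right [simp]: "cinner x (- y) = - cinner x y"
  using cinner_add_right[of x "- y" y] by (simp add: eq_neg_iff_add_eq_0)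

lemma cinner_diff_left: "cinner (x - y) z = cinner x z - cinner y z"
  using cinner_add_left[of x "- y" z] by simp

lemma cinner_diff_right: "cinner x (y - z) = cinner x y - cinner x z"
  using cinner_add_right[of x y "- z"] by simp

lemmas cinner_simps =
  cinner_add_left cinner_add_right cinner_diff_left cinner_diff_right
  cinner_scaleC_left cinner_scaleC_right

lemma cinner_sum_left: "cinner (\<Sum>a\<in>A. f a) y = (\<Sum>a\<in>A. cinner (f a) y)"
  by (induction A rule: infinite_finite_induct) (simp_all add: cinner_add_left)

lemma cinner_sum_right: "cinner x (\<Sum>a\<in>A. f a) = (\<Sum>a\<in>A. cinner x (f a))"
  by (induction A rule: infinite_finite_induct) (simp_all add: cinner_add_right)

lemma cinner_eq_zero_commute: "cinner x y = 0 \<longleftrightarrow> cinner y x = 0"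
  by (metis cinner_commute complex_cnj_zero)

lemma cinner_self_eq_zero [simp]: "cinner x x = 0 \<longleftrightarrow> x = 0"
  by (simp add: cinner_self)

lemma cmod_cinner_le: "cmod (cinner x y) \<le> norm x * norm y"
proof (cases "cinner x y = 0")
  case False
  let ?c = "cinner x y" and ?w = "cnj (sgn (cinner x y))"
  \<comment> \<open>Rotating \<open>x\<close> makes the inner product real, and the real Cauchy--Schwarz inequality applies.\<close>
  have "?w * ?c = complex_of_real (cmod ?c)"
    using False by (simp add: sgn_eq complex_norm_square[symmetric] power2_eq_square
      mult.commute)
  then have "cmod ?c = inner (?w *\<^sub>C x) y"
    by (metis Re_cinner Re_complex_of_real cinner_scaleC_left)
  also have "\<dots> \<le> norm (?w *\<^sub>C x) * norm y"
    by (rule norm_cauchy_schwarz)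
  also have "\<dots> = norm x * norm y"
    using False by (simp add: norm_scaleC norm_sgn)
  finally show ?thesis .
qed simp

lemma tendsto_cinner_left:
  assumes "(f \<longlongrightarrow> x) F" shows "((\<lambda>i. cinner (f i) y) \<longlongrightarrow> cinner x y) F"
proof -
  have "((\<lambda>i. \<i> *\<^sub>C f i) \<longlongrightarrow> \<i> *\<^sub>C x) F"
    by (rule bounded_linear.tendsto[OF bounded_linear_scaleC assms])
  with assms show ?thesis
    by (auto simp: tendsto_complex_iff Re_cinner Im_cinner intro!: tendsto_intros)
qed

lemma closed_cinner_zero: "closed {x. cinner x y = 0}"
proof -
  have "continuous_on UNIV (\<lambda>x. cinner x y)"
    unfolding continuous_on_def by (auto intro: tendsto_cinner_left tendsto_ident_at)
  then show ?thesis
    by (rule closed_Collect_eq) simp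
qed

section \<open>Orthogonal projections\<close>

definition closed_csubspace :: "'h::complex_hilbert_space set \<Rightarrow> bool"
  where "closed_csubspace M \<longleftrightarrow> cvec.subspace M \<and> closed M"

lemma closed_csubspace_intros:
  assumes "closed_csubspace M"
  shows "0 \<in> M" and "x \<in> M \<Longrightarrow> y \<in> M \<Longrightarrow> x + y \<in> M"
    and "x \<in> M \<Longrightarrow> y \<in> M \<Longrightarrow> x - y \<in> M" and "x \<in> M \<Longrightarrow> c *\<^sub>C x \<in> M"
    and "x \<in> M \<Longrightarrow> r *\<^sub>R x \<in> M"
  using assms unfolding closed_csubspace_def
  by (auto intro: cvec.subspace_0 cvec.subspace_add cvec.subspace_diff cvec.subspace_scale
      simp flip: scaleC_of_real)

lemma closed_csubspace_UNIV: "closed_csubspace UNIV"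
  by (simp add: closed_csubspace_def)

lemma closed_csubspace_Inter:
  "(\<And>M. M \<in> \<S> \<Longrightarrow> closed_csubspace M) \<Longrightarrow> closed_csubspace (\<Inter>\<S>)"
  unfolding closed_csubspace_def by (auto intro: cvec.subspace_Inter)

lemma closed_csubspace_closure:
  assumes "cvec.subspace M" shows "closed_csubspace (closure M)"
proof -
  have "x + y \<in> closure M" if x: "x \<in> closure M" and y: "y \<in> closure M" for x y
  proof -
    obtain f g where f: "\<And>n. f n \<in> M" "f \<longlonglongrightarrow> x" and g: "\<And>n. g n \<in> M" "g \<longlonglongrightarrow> y"
      using x y unfolding closure_sequential by blast
    then have "(\<lambda>n. f n + g n) \<longlonglongrightarrow> x + y" "\<And>n. f n + g n \<in> M"
      using assms by (auto intro: tendsto_add cvec.subspace_add)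
    then show ?thesis unfolding closure_sequential by (intro exI[of _ "(\<lambda>n. f n + g n)"]) auto
  qed
  moreover have "c *\<^sub>C x \<in> closure M" if x: "x \<in> closure M" for c x
  proof -
    obtain f where f: "\<And>n. f n \<in> M" "f \<longlonglongrightarrow> x"
      using x unfolding closure_sequential by blast
    then have "(\<lambda>n. c *\<^sub>C f n) \<longlonglongrightarrow> c *\<^sub>C x" "\<And>n. c *\<^sub>C f n \<in> M"
      using assms by (auto intro: bounded_linear.tendsto[OF bounded_linear_scaleC]
        cvec.subspace_scale)
    then show ?thesis unfolding closure_sequential by (intro exI[of _ "(\<lambda>n. c *\<^sub>C f n)"]) auto
  qed
  moreover have "0 \<in> closure M"
    using assms cvec.subspace_0 closure_subset by blast
  ultimately show ?thesis
    by (simp add: closed_csubspace_def cvec.subspace_def)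
qed

lemma closed_csubspace_closure_Union:
  assumes "\<And>M. M \<in> \<S> \<Longrightarrow> closed_csubspace M" "\<S> \<noteq> {}"
    and "\<And>M N. M \<in> \<S> \<Longrightarrow> N \<in> \<S> \<Longrightarrow> M \<subseteq> N \<or> N \<subseteq> M"
  shows "closed_csubspace (closure (\<Union>\<S>))"
proof (rule closed_csubspace_closure, unfold cvec.subspace_def, intro conjI ballI allI)
  show "0 \<in> \<Union>\<S>"
    using assms(1,2) closed_csubspace_intros(1) by blast
  show "c *\<^sub>C x \<in> \<Union>\<S>" if "x \<in> \<Union>\<S>" for c x
    using that assms(1) closed_csubspace_intros(4) by blast
  show "x + y \<in> \<Union>\<S>" if xy: "x \<in> \<Union>\<S>" "y \<in> \<Union>\<S>" for x y
  proof -
    obtain M N where "M \<in> \<S>" "x \<in> M" "N \<in> \<S>" "y \<in> N" using xy by blast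
    then show ?thesis
      using assms(1,3)[of M] assms(1,3)[of N] closed_csubspace_intros(2) by (metis UnionI subsetD)
  qed
qed

lemma closed_csubspace_orthogonal: "closed_csubspace {x. \<forall>y\<in>S. cinner x y = 0}"
proof -
  have "{x. \<forall>y\<in>S. cinner x y = 0} = (\<Inter>y\<in>S. {x. cinner x y = 0})" by auto
  then show ?thesis
    unfolding closed_csubspace_def cvec.subspace_def
    by (auto simp: cinner_simps intro!: closed_INT closed_cinner_zero)
qed

text \<open>
  A minimising sequence for the distance to the subspace is Cauchy by the parallelogram law; its
  limit is the foot of the perpendicular.
\<close>

lemma orthogonal_projection_exists:
  fixes x :: "'h::complex_hilbert_space"
  assumes M: "closed_csubspace M"
  obtains p where "p \<in> M" "\<And>y. y \<in> M \<Longrightarrow> cinner (x - p) y = 0"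
proof -
  note Mi = closed_csubspace_intros[OF M]
  define g where "g m = (norm (x - m))\<^sup>2" for m
  define d where "d = Inf (g ` M)"
  have bdd: "bdd_below (g ` M)" by (auto simp: g_def intro!: bdd_belowI[of _ 0])
  have d_le: "d \<le> g m" if "m \<in> M" for m
    unfolding d_def using bdd that by (auto intro: cInf_lower)
  have "\<exists>m\<in>M. g m < d + inverse (real (Suc n))" for n
    using cInf_lessD[of "g ` M" "d + inverse (real (Suc n))"] Mi(1) by (auto simp: d_def)
  then obtain u where uM: "\<And>n. u n \<in> M" and u: "\<And>n. g (u n) < d + inverse (real (Suc n))"
    by metis
  have par: "(norm (a - b))\<^sup>2 \<le> 2 * g a + 2 * g b - 4 * d" if "a \<in> M" "b \<in> M" for a b
  proof -
    have "(norm (a - b))\<^sup>2 = 2 * g a + 2 * g b - 4 * g ((1/2) *\<^sub>R (a + b))"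
      unfolding g_def power2_norm_eq_inner
      by (simp add: inner_simps inner_commute[of b a] inner_commute[of a x] inner_commute[of b x]
        field_simps)
    then show ?thesis using d_le[of "(1/2) *\<^sub>R (a + b)"] that Mi by simp
  qed
  have "Cauchy u"
  proof (rule metric_CauchyI)
    fix e :: real assume "e > 0"
    then obtain N where N: "inverse (real (Suc N)) < e\<^sup>2 / 4"
      using reals_Archimedean[of "e\<^sup>2 / 4"] by auto
    have "dist (u i) (u j) < e" if "i \<ge> N" "j \<ge> N" for i j
    proof -
      have "inverse (real (Suc i)) \<le> inverse (real (Suc N))"
        "inverse (real (Suc j)) \<le> inverse (real (Suc N))"
        using that by (auto intro!: le_imp_inverse_le)
      then have "(norm (u i - u j))\<^sup>2 < e\<^sup>2"
        using par[OF uM uM, of i j] u[of i] u[of j] N by linarith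
      then show ?thesis
        using \<open>e > 0\<close> by (simp add: dist_norm power2_less_imp_less)
    qed
    then show "\<exists>M. \<forall>i\<ge>M. \<forall>j\<ge>M. dist (u i) (u j) < e" by blast
  qed
  then obtain p where p: "u \<longlonglongrightarrow> p"
    using Cauchy_convergent convergent_def by blast
  have pM: "p \<in> M"
    using M uM p closed_sequentially unfolding closed_csubspace_def by blast
  have "(\<lambda>n. g (u n)) \<longlonglongrightarrow> g p"
    unfolding g_def by (intro tendsto_intros p)
  moreover have "(\<lambda>n. d + inverse (real (Suc n))) \<longlonglongrightarrow> d + 0"
    by (intro tendsto_intros LIMSEQ_inverse_real_of_nat)
  ultimately have "g p \<le> d + 0"
    by (rule LIMSEQ_le) (meson u less_imp_le)
  then have min: "g p \<le> g m" if "m \<in> M" for m using d_le[OF that] by simp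
  have re: "inner (x - p) y = 0" if y: "y \<in> M" for y
  proof -
    define a b where "a = inner (x - p) y" and "b = inner y y"
    have "b \<ge> 0" by (simp add: b_def)
    let ?t = "a / (b + 1)"
    have expand: "g (p + t *\<^sub>R y) = g p - 2 * t * a + t\<^sup>2 * b" for t
      unfolding g_def power2_norm_eq_inner a_def b_def
      by (simp add: inner_simps inner_commute field_simps power2_eq_square)
    have "0 \<le> - 2 * ?t * a + ?t\<^sup>2 * b"
      using min[OF Mi(2)[OF pM Mi(5)[OF y, of ?t]]] expand[of ?t] by linarith
    also have "\<dots> = - (a\<^sup>2 * (b + 2)) / (b + 1)\<^sup>2"
      using \<open>b \<ge> 0\<close> by (simp add: divide_simps) (simp add: algebra_simps power2_eq_square)
    finally have "a\<^sup>2 * (b + 2) \<le> 0"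
      using \<open>b \<ge> 0\<close> by (simp add: divide_simps split: if_splits)
    then show ?thesis
      using \<open>b \<ge> 0\<close> unfolding a_def by (smt (verit) mult_pos_pos zero_less_power2)
  qed
  have "cinner (x - p) y = 0" if y: "y \<in> M" for y
  proof (rule complex_eqI)
    have "Im (cinner (x - p) y) = Re (cinner (x - p) (\<i> *\<^sub>C y))"
      by (simp add: cinner_scaleC_right)
    then show "Im (cinner (x - p) y) = Im 0"
      using re[OF Mi(4)[OF y, of \<i>]] by (simp add: Re_cinner)
  qed (simp add: Re_cinner re[OF y])
  with pM show thesis by (rule that)
qed

definition proj :: "'h::complex_hilbert_space set \<Rightarrow> 'h \<Rightarrow> 'h"
  where "proj M x = (SOME p. p \<in> M \<and> (\<forall>y\<in>M. cinner (x - p) y = 0))"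

lemma
  assumes "closed_csubspace M"
  shows proj_in: "proj M x \<in> M"
    and proj_residual: "y \<in> M \<Longrightarrow> cinner (x - proj M x) y = 0"
proof -
  have "\<exists>p. p \<in> M \<and> (\<forall>y\<in>M. cinner (x - p) y = 0)"
    using orthogonal_projection_exists[OF assms] by metis
  from someI_ex[OF this] show "proj M x \<in> M" "y \<in> M \<Longrightarrow> cinner (x - proj M x) y = 0"
    by (auto simp: proj_def)
qed

lemma cinner_proj_left:
  "closed_csubspace M \<Longrightarrow> y \<in> M \<Longrightarrow> cinner (proj M x) y = cinner x y"
  using proj_residual[of M y x] by (simp add: cinner_diff_left)

lemma cinner_proj_right:
  "closed_csubspace M \<Longrightarrow> y \<in> M \<Longrightarrow> cinner y (proj M x) = cinner y x"
  by (metis cinner_commute cinner_proj_left)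

lemma proj_unique:
  assumes "closed_csubspace M" "p \<in> M" "\<And>y. y \<in> M \<Longrightarrow> cinner (x - p) y = 0"
  shows "proj M x = p"
proof -
  have d: "proj M x - p \<in> M"
    using assms by (simp add: closed_csubspace_intros proj_in)
  then have "cinner (proj M x - p) (proj M x - p) = 0"
    using proj_residual[OF assms(1) d, of x] assms(3)[OF d] by (simp add: cinner_diff_left)
  then show ?thesis by simp
qed

lemma proj_id: "closed_csubspace M \<Longrightarrow> x \<in> M \<Longrightarrow> proj M x = x"
  by (rule proj_unique) auto

lemma proj_selfadjoint: "closed_csubspace M \<Longrightarrow> cinner (proj M x) y = cinner x (proj M y)"
  by (metis cinner_proj_left cinner_proj_right proj_in)

lemma cinner_proj_nested:
  assumes "closed_csubspace M" "closed_csubspace N" "M \<subseteq> N"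
  shows "cinner (proj M x) (proj N y) = cinner (proj M x) y"
    and "cinner (proj N y) (proj M x) = cinner y (proj M x)"
  using assms proj_in by (blast intro: cinner_proj_right cinner_proj_left)+

lemma cinner_proj_self:
  "closed_csubspace M \<Longrightarrow> cinner x (proj M x) = complex_of_real ((norm (proj M x))\<^sup>2)"
  by (metis cinner_proj_left cinner_self proj_in)

lemma norm_residual:
  assumes "closed_csubspace M"
  shows "(norm (x - proj M x))\<^sup>2 = (norm x)\<^sup>2 - (norm (proj M x))\<^sup>2"
proof -
  have "cinner (x - proj M x) (x - proj M x) = cinner (x - proj M x) x"
    using proj_residual[OF assms proj_in[OF assms]] by (simp add: cinner_diff_right)
  also have "\<dots> = cinner x x - cinner (proj M x) x" by (simp add: cinner_diff_left)
  also have "cinner (proj M x) x = complex_of_real ((norm (proj M x))\<^sup>2)"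
    using cinner_proj_self[OF assms] proj_selfadjoint[OF assms] by simp
  finally show ?thesis unfolding cinner_self by (metis of_real_diff of_real_eq_iff)
qed

lemma norm_proj_mono:
  assumes "closed_csubspace M" "closed_csubspace N" "M \<subseteq> N"
  shows "norm (proj M x) \<le> norm (proj N x)"
proof -
  have "(norm (proj M x))\<^sup>2 = cmod (cinner (proj M x) (proj N x))"
    using cinner_proj_nested(1)[OF assms] cinner_proj_self[OF assms(1)]
      proj_selfadjoint[OF assms(1)] by (metis abs_of_nonneg norm_of_real zero_le_power2)
  also have "\<dots> \<le> norm (proj M x) * norm (proj N x)"
    by (rule cmod_cinner_le)
  finally show ?thesis
    by (cases "proj M x = 0") (simp_all add: power2_eq_square)
qed

lemma proj_UNIV [simp]: "proj UNIV x = x"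
  by (simp add: proj_id closed_csubspace_UNIV)

lemma norm_proj_le: "closed_csubspace M \<Longrightarrow> norm (proj M x) \<le> norm x"
  using norm_proj_mono[of M UNIV x] closed_csubspace_UNIV by simp

section \<open>Maximal nests\<close>

text \<open>
  Projections are continuous from below along a chain: the bound \<open>\<langle>q, y\<rangle> \<le> s \<parallel>q\<parallel>\<close> holds for \<open>q\<close> in
  the union and is a closed condition on \<open>q\<close>, so it applies to the projection itself.
\<close>

lemma norm_proj_closure_Union_le:
  assumes \<S>: "\<And>M. M \<in> \<S> \<Longrightarrow> closed_csubspace M" "\<S> \<noteq> {}"
      "\<And>M N. M \<in> \<S> \<Longrightarrow> N \<in> \<S> \<Longrightarrow> M \<subseteq> N \<or> N \<subseteq> M"
    and le: "\<And>M. M \<in> \<S> \<Longrightarrow> norm (proj M y) \<le> s"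
  shows "norm (proj (closure (\<Union>\<S>)) y) \<le> s"
proof -
  let ?U = "closure (\<Union>\<S>)"
  have U: "closed_csubspace ?U"
    by (rule closed_csubspace_closure_Union[OF \<S>])
  have "inner q y \<le> norm q * s" if q: "q \<in> \<Union>\<S>" for q
  proof -
    obtain M where M: "M \<in> \<S>" "q \<in> M" using q by blast
    then have "inner q y = inner q (proj M y)"
      using cinner_proj_right[OF \<S>(1)] by (metis Re_cinner)
    also have "\<dots> \<le> norm q * norm (proj M y)" by (rule norm_cauchy_schwarz)
    also have "\<dots> \<le> norm q * s" using le[OF M(1)] by (simp add: mult_left_mono)
    finally show ?thesis .
  qed
  moreover have "closed {q. inner q y \<le> norm q * s}"
    by (intro closed_Collect_le continuous_intros)
  ultimately have "?U \<subseteq> {q. inner q y \<le> norm q * s}"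
    by (intro closure_minimal) auto
  then have "inner (proj ?U y) y \<le> norm (proj ?U y) * s"
    using proj_in[OF U] by blast
  moreover have "inner (proj ?U y) y = norm (proj ?U y) * norm (proj ?U y)"
    using cinner_proj_self[OF U, of y] proj_selfadjoint[OF U, of y y]
    by (metis Re_cinner Re_complex_of_real power2_eq_square)
  moreover have "0 \<le> s"
    using \<S>(2) le norm_ge_zero order_trans by (metis ex_in_conv)
  ultimately show ?thesis
    by (cases "proj ?U y = 0") simp_all
qed

lemma proj_orthogonal_complement:
  assumes "closed_csubspace M"
  shows "proj {x. \<forall>y\<in>M. cinner x y = 0} x = x - proj M x"
proof (rule proj_unique)
  show "x - proj M x \<in> {x. \<forall>y\<in>M. cinner x y = 0}"
    by (simp add: proj_residual assms)
  show "cinner (x - (x - proj M x)) y = 0" if "y \<in> {x. \<forall>y\<in>M. cinner x y = 0}" for y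
    using that proj_in[OF assms] by (simp add: cinner_eq_zero_commute[of _ y])
qed (rule closed_csubspace_orthogonal)

text \<open>
  The orthogonal complements of a chain form a chain, and the residual of the projection onto the
  intersection is the projection onto the closed union of the complements.
\<close>

lemma norm_proj_Inter_ge:
  assumes \<S>: "\<And>M. M \<in> \<S> \<Longrightarrow> closed_csubspace M" "\<S> \<noteq> {}"
      "\<And>M N. M \<in> \<S> \<Longrightarrow> N \<in> \<S> \<Longrightarrow> M \<subseteq> N \<or> N \<subseteq> M"
    and ge: "\<And>M. M \<in> \<S> \<Longrightarrow> t \<le> (norm (proj M y))\<^sup>2"
  shows "t \<le> (norm (proj (\<Inter>\<S>) y))\<^sup>2"
proof -
  define perp :: "'a set \<Rightarrow> 'a set" where "perp M = {x. \<forall>y\<in>M. cinner x y = 0}" for M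
  let ?U = "closure (\<Union>(perp ` \<S>))"
  let ?s = "(norm y)\<^sup>2 - t"
  have perp: "closed_csubspace (perp M)" for M
    unfolding perp_def by (rule closed_csubspace_orthogonal)
  have perp_chain: "P \<subseteq> Q \<or> Q \<subseteq> P" if "P \<in> perp ` \<S>" "Q \<in> perp ` \<S>" for P Q
  proof -
    obtain M N where MN: "M \<in> \<S>" "N \<in> \<S>" "P = perp M" "Q = perp N" using \<open>P \<in> _\<close> \<open>Q \<in> _\<close> by blast
    with \<S>(3)[OF MN(1,2)] show ?thesis unfolding perp_def by blast
  qed
  have U: "closed_csubspace ?U"
    using perp \<S>(2) perp_chain by (intro closed_csubspace_closure_Union) auto
  have I: "closed_csubspace (\<Inter>\<S>)"
    using \<S>(1) by (rule closed_csubspace_Inter)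
  have "norm (proj P y) \<le> sqrt ?s" if P: "P \<in> perp ` \<S>" for P
  proof -
    obtain M where M: "M \<in> \<S>" "P = perp M" using P by blast
    then have "(norm (proj P y))\<^sup>2 = (norm y)\<^sup>2 - (norm (proj M y))\<^sup>2"
      using proj_orthogonal_complement[OF \<S>(1)] norm_residual[OF \<S>(1)] by (simp add: perp_def)
    then show ?thesis using ge[OF M(1)] by (intro real_le_rsqrt) simp
  qed
  then have U_le: "norm (proj ?U y) \<le> sqrt ?s"
    using perp \<S>(2) perp_chain by (intro norm_proj_closure_Union_le) auto
  have "proj (\<Inter>\<S>) y = y - proj ?U y"
  proof (rule proj_unique[OF I])
    have "y - proj ?U y \<in> M" if M: "M \<in> \<S>" for M
    proof -
      let ?r = "y - proj ?U y"
      have m: "?r - proj M ?r \<in> perp M"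
        by (simp add: perp_def proj_residual[OF \<S>(1)[OF M]])
      then have "?r - proj M ?r \<in> ?U"
        using M closure_subset by fastforce
      then have "cinner ?r (?r - proj M ?r) = 0" by (rule proj_residual[OF U])
      moreover have "cinner (?r - proj M ?r) (proj M ?r) = 0"
        by (simp add: proj_residual proj_in \<S>(1)[OF M])
      ultimately have "cinner (?r - proj M ?r) (?r - proj M ?r) = 0"
        by (metis cinner_diff_left cinner_eq_zero_commute diff_zero)
      then have "?r = proj M ?r" by simp
      then show ?thesis using proj_in[OF \<S>(1)[OF M], of ?r] by simp
    qed
    then show "y - proj ?U y \<in> \<Inter>\<S>" by blast
    show "cinner (y - (y - proj ?U y)) z = 0" if z: "z \<in> \<Inter>\<S>" for z
    proof -
      have "?U \<subseteq> {x. cinner x z = 0}"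
        using z by (intro closure_minimal closed_cinner_zero) (auto simp: perp_def)
      then show ?thesis using proj_in[OF U] by auto
    qed
  qed
  then have "(norm (proj (\<Inter>\<S>) y))\<^sup>2 = (norm y)\<^sup>2 - (norm (proj ?U y))\<^sup>2"
    using norm_residual[OF U] by simp
  moreover have "(norm (proj ?U y))\<^sup>2 \<le> ?s"
    using power_mono[OF U_le norm_ge_zero, of 2] order_trans[OF norm_ge_zero U_le] by simp
  ultimately show ?thesis by simp
qed

text \<open>
  Maximality supplies completeness: \<open>{0}\<close>, the whole space, closed unions and intersections of
  members are comparable with every member, hence are members.
\<close>

locale maximal_nest =
  fixes \<N> :: "'h::complex_hilbert_space set set"
  assumes closed_csubspace: "M \<in> \<N> \<Longrightarrow> closed_csubspace M"
    and chain: "M \<in> \<N> \<Longrightarrow> N \<in> \<N> \<Longrightarrow> M \<subseteq> N \<or> N \<subseteq> M"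
    and maximal: "closed_csubspace M \<Longrightarrow> (\<And>N. N \<in> \<N> \<Longrightarrow> M \<subseteq> N \<or> N \<subseteq> M) \<Longrightarrow> M \<in> \<N>"

lemma maximal_nest_extension:
  fixes \<C> :: "'h::complex_hilbert_space set set"
  assumes "\<And>M. M \<in> \<C> \<Longrightarrow> closed_csubspace M"
    and "\<And>M N. M \<in> \<C> \<Longrightarrow> N \<in> \<C> \<Longrightarrow> M \<subseteq> N \<or> N \<subseteq> M"
  obtains \<N> where "maximal_nest \<N>" "\<C> \<subseteq> \<N>"
proof -
  define \<A> where "\<A> = {\<D>. \<C> \<subseteq> \<D> \<and> (\<forall>M\<in>\<D>. closed_csubspace M) \<and>
    (\<forall>M\<in>\<D>. \<forall>N\<in>\<D>. M \<subseteq> N \<or> N \<subseteq> M)}"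
  have "\<exists>\<N>\<in>\<A>. \<forall>X\<in>\<A>. \<N> \<subseteq> X \<longrightarrow> X = \<N>"
  proof (rule subset_Zorn_nonempty)
    have "\<C> \<in> \<A>" using assms by (simp add: \<A>_def)
    then show "\<A> \<noteq> {}" by blast
    fix \<K> assume \<K>: "\<K> \<noteq> {}" "subset.chain \<A> \<K>"
    then have "\<K> \<subseteq> \<A>" and ch: "\<And>X Y. X \<in> \<K> \<Longrightarrow> Y \<in> \<K> \<Longrightarrow> X \<subseteq> Y \<or> Y \<subseteq> X"
      by (auto simp: subset_chain_def)
    have "M \<subseteq> N \<or> N \<subseteq> M" if MN: "M \<in> \<Union>\<K>" "N \<in> \<Union>\<K>" for M N
    proof -
      obtain X Y where "X \<in> \<K>" "Y \<in> \<K>" "M \<in> X" "N \<in> Y" using MN by blast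
      then obtain W where W: "W \<in> \<K>" "M \<in> W" "N \<in> W" using ch[of X Y] by blast
      then have "W \<in> \<A>" using \<open>\<K> \<subseteq> \<A>\<close> by blast
      with W(2,3) show ?thesis unfolding \<A>_def by simp
    qed
    moreover have "\<forall>X\<in>\<K>. \<C> \<subseteq> X \<and> (\<forall>M\<in>X. closed_csubspace M)"
      using \<open>\<K> \<subseteq> \<A>\<close> unfolding \<A>_def by blast
    then have "\<C> \<subseteq> \<Union>\<K>" "\<forall>M\<in>\<Union>\<K>. closed_csubspace M"
      using \<K>(1) by (metis Sup_upper2 equals0I, metis UnionE)
    ultimately show "\<Union>\<K> \<in> \<A>"
      unfolding \<A>_def by auto
  qed
  then obtain \<N> where N: "\<N> \<in> \<A>" and max: "\<And>X. X \<in> \<A> \<Longrightarrow> \<N> \<subseteq> X \<Longrightarrow> X = \<N>" by blast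
  have "maximal_nest \<N>"
  proof
    fix M assume "closed_csubspace M" "\<And>N. N \<in> \<N> \<Longrightarrow> M \<subseteq> N \<or> N \<subseteq> M"
    then have "insert M \<N> \<in> \<A>" using N unfolding \<A>_def by auto
    from max[OF this] show "M \<in> \<N>" by blast
  qed (use N in \<open>auto simp: \<A>_def\<close>)
  with N show thesis by (auto simp: \<A>_def intro: that)
qed

context maximal_nest
begin

lemma UNIV_mem: "UNIV \<in> \<N>"
  by (rule maximal[OF closed_csubspace_UNIV]) auto

text \<open>
  In terms of the spectral measure of \<open>z\<close> with respect to the nest: a point mass, respectively a
  measure without point masses.
\<close>

definition atomic_vector :: "'h \<Rightarrow> bool"
  where "atomic_vector z \<longleftrightarrow> (\<forall>M\<in>\<N>. z \<in> M \<or> (\<forall>m\<in>M. cinner m z = 0))"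

definition diffuse_vector :: "'h \<Rightarrow> bool"
  where "diffuse_vector z \<longleftrightarrow> (\<forall>t\<in>{0..(norm z)\<^sup>2}. \<exists>M\<in>\<N>. (norm (proj M z))\<^sup>2 = t)"

text \<open>
  If the value \<open>t\<close> is skipped, it is skipped by a jump: the members below \<open>t\<close> and those above \<open>t\<close>
  are separated by the closed union of the former and the intersection of the latter.  No member
  of the nest lies strictly between these two, so the part of \<open>y\<close> between them is atomic.
\<close>

lemma diffuse_or_atomic_part:
  assumes "\<not> diffuse_vector y"
  obtains M N where "M \<in> \<N>" "N \<in> \<N>" "proj N y - proj M y \<noteq> 0"
    "atomic_vector (proj N y - proj M y)"
proof -
  obtain t where t: "0 \<le> t" "t \<le> (norm y)\<^sup>2" and no: "\<And>M. M \<in> \<N> \<Longrightarrow> (norm (proj M y))\<^sup>2 \<noteq> t"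
    using assms unfolding diffuse_vector_def by auto
  define \<L> \<U> where "\<L> = {K \<in> \<N>. (norm (proj K y))\<^sup>2 \<le> t}" and "\<U> = {K \<in> \<N>. t \<le> (norm (proj K y))\<^sup>2}"
  define M N where "M = closure (\<Union>\<L>)" and "N = \<Inter>\<U>"
  have zero: "closed_csubspace {0}" by (simp add: closed_csubspace_def)
  then have "{0} \<in> \<N>"
    by (rule maximal) (use closed_csubspace closed_csubspace_intros(1) in auto)
  then have L0: "\<L> \<noteq> {}"
    using t proj_in[OF zero, of y] by (auto simp: \<L>_def intro!: exI[of _ "{0}"])
  have U0: "\<U> \<noteq> {}"
    using t UNIV_mem by (auto simp: \<U>_def intro!: exI[of _ UNIV])
  have less: "K \<subseteq> K'" if "K \<in> \<L>" "K' \<in> \<U>" for K K'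
  proof (rule ccontr)
    assume "\<not> K \<subseteq> K'"
    have KK: "K \<in> \<N>" "K' \<in> \<N>" using that by (auto simp: \<L>_def \<U>_def)
    then have "norm (proj K' y) \<le> norm (proj K y)"
      using \<open>\<not> K \<subseteq> K'\<close> chain closed_csubspace by (intro norm_proj_mono) auto
    then have "(norm (proj K' y))\<^sup>2 \<le> (norm (proj K y))\<^sup>2" by (rule power_mono) simp
    moreover have "(norm (proj K y))\<^sup>2 \<le> t" "t \<le> (norm (proj K' y))\<^sup>2"
      using that by (auto simp: \<L>_def \<U>_def)
    ultimately have "(norm (proj K y))\<^sup>2 = t" by linarith
    with no KK show False by blast
  qed
  have cN: "closed_csubspace N"
    unfolding N_def by (rule closed_csubspace_Inter) (auto simp: \<U>_def closed_csubspace)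
  have cM: "closed_csubspace M"
    unfolding M_def using L0 chain
    by (intro closed_csubspace_closure_Union) (auto simp: \<L>_def closed_csubspace)
  have M_le: "M \<subseteq> K" if "K \<in> \<U>" for K
    unfolding M_def using that less closed_csubspace[of K]
    by (intro closure_minimal) (auto simp: \<U>_def closed_csubspace_def)
  have M_ge: "K \<subseteq> M" if "K \<in> \<L>" for K
    unfolding M_def using that closure_subset[of "\<Union>\<L>"] by blast
  have N_le: "N \<subseteq> K" if "K \<in> \<U>" for K
    using that by (auto simp: N_def)
  have N_ge: "K \<subseteq> N" if "K \<in> \<L>" for K
    using that less by (auto simp: N_def)
  have "M \<subseteq> N" using M_le by (auto simp: N_def)
  have cases: "K \<in> \<L> \<or> K \<in> \<U>" if "K \<in> \<N>" for K
    using that by (auto simp: \<L>_def \<U>_def)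
  have "M \<in> \<N>" using M_le M_ge cases by (intro maximal[OF cM]) metis
  have "N \<in> \<N>" using N_le N_ge cases by (intro maximal[OF cN]) metis
  have "norm (proj M y) \<le> sqrt t"
    unfolding M_def using L0 chain
    by (intro norm_proj_closure_Union_le) (auto simp: \<L>_def closed_csubspace real_le_rsqrt)
  from power_mono[OF this norm_ge_zero, of 2] have "(norm (proj M y))\<^sup>2 \<le> t"
    using t by simp
  moreover have "t \<le> (norm (proj N y))\<^sup>2"
    unfolding N_def using U0 chain
    by (intro norm_proj_Inter_ge) (auto simp: \<U>_def closed_csubspace)
  ultimately have ne: "proj N y - proj M y \<noteq> 0"
    using no[OF \<open>M \<in> \<N>\<close>] by force
  have "atomic_vector (proj N y - proj M y)"
    unfolding atomic_vector_def
  proof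
    fix K assume "K \<in> \<N>"
    then consider "K \<in> \<L>" | "K \<in> \<U>" using cases by metis
    then show "proj N y - proj M y \<in> K \<or> (\<forall>m\<in>K. cinner m (proj N y - proj M y) = 0)"
    proof cases
      case 1
      then have "cinner m (proj N y - proj M y) = 0" if "m \<in> K" for m
        using that M_ge N_ge
        by (metis cM cN cinner_diff_right cinner_proj_right diff_self subsetD)
      then show ?thesis by blast
    next
      case 2
      then have "proj N y - proj M y \<in> K"
        using N_le M_le proj_in[OF cN] proj_in[OF cM] closed_csubspace[OF \<open>K \<in> \<N>\<close>]
        by (meson closed_csubspace_intros(3) subsetD)
      then show ?thesis by blast
    qed
  qed
  with \<open>M \<in> \<N>\<close> \<open>N \<in> \<N>\<close> ne show thesis by (rule that)
qed

end

section \<open>Finite sums of rank-one operators\<close>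

definition orthonormal :: "'i set \<Rightarrow> ('i \<Rightarrow> 'h::complex_hilbert_space) \<Rightarrow> bool"
  where "orthonormal I e \<longleftrightarrow> (\<forall>i\<in>I. \<forall>j\<in>I. cinner (e i) (e j) = (if i = j then 1 else 0))"

definition rank_sum ::
    "'i set \<Rightarrow> ('i \<Rightarrow> 'h) \<Rightarrow> ('i \<Rightarrow> 'h) \<Rightarrow> 'h \<Rightarrow> 'h::complex_hilbert_space"
  where "rank_sum I u v x = (\<Sum>i\<in>I. cinner x (v i) *\<^sub>C u i)"

lemma norm_orthonormal_sum:
  assumes "finite I" "orthonormal I u"
  shows "(norm (\<Sum>i\<in>I. c i *\<^sub>C u i))\<^sup>2 = (\<Sum>i\<in>I. (cmod (c i))\<^sup>2)"
proof -
  have "cinner (\<Sum>i\<in>I. c i *\<^sub>C u i) (\<Sum>i\<in>I. c i *\<^sub>C u i)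
      = (\<Sum>i\<in>I. \<Sum>j\<in>I. c i * (cnj (c j) * cinner (u i) (u j)))"
    by (subst cinner_sum_left)
      (simp add: cinner_sum_right cinner_scaleC_left cinner_scaleC_right sum_distrib_left mult_ac)
  also have "\<dots> = (\<Sum>i\<in>I. \<Sum>j\<in>I. if i = j then c i * cnj (c i) else 0)"
    using assms(2) by (intro sum.cong refl) (auto simp: orthonormal_def)
  also have "\<dots> = complex_of_real (\<Sum>i\<in>I. (cmod (c i))\<^sup>2)"
    using assms(1) by (simp only: sum.delta of_real_sum complex_norm_square) simp
  finally show ?thesis unfolding cinner_self by (metis of_real_eq_iff)
qed

lemma bessel_inequality:
  assumes "finite I" "orthonormal I v"
  shows "(\<Sum>i\<in>I. (cmod (cinner x (v i)))\<^sup>2) \<le> (norm x)\<^sup>2"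
proof -
  define p where "p = (\<Sum>i\<in>I. cinner x (v i) *\<^sub>C v i)"
  have p: "(norm p)\<^sup>2 = (\<Sum>i\<in>I. (cmod (cinner x (v i)))\<^sup>2)"
    unfolding p_def by (rule norm_orthonormal_sum[OF assms])
  have "cinner x p = (\<Sum>i\<in>I. cinner x (v i) * cnj (cinner x (v i)))"
    by (simp add: p_def cinner_sum_right cinner_scaleC_right mult.commute)
  then have "cinner x p = complex_of_real ((norm p)\<^sup>2)"
    by (simp add: p complex_norm_square[symmetric])
  then have "norm p * norm p \<le> norm x * norm p"
    using cmod_cinner_le[of x p] by (simp add: norm_mult power2_eq_square)
  then have "norm p \<le> norm x" by (cases "p = 0") auto
  then show ?thesis unfolding p[symmetric] by (rule power_mono) simp
qed

lemma norm_rank_sum_le: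
  assumes "finite I" "orthonormal I u" "orthonormal I v"
  shows "norm (rank_sum I u v x) \<le> norm x"
proof -
  have "(norm (rank_sum I u v x))\<^sup>2 \<le> (norm x)\<^sup>2"
    unfolding rank_sum_def using bessel_inequality[OF assms(1,3)]
    by (simp add: norm_orthonormal_sum[OF assms(1,2)])
  then show ?thesis by (simp add: power2_le_iff_abs_le)
qed

lemma rank_sum_blinfun:
  assumes "finite I" "orthonormal I u" "orthonormal I v"
  obtains F where "blinfun_apply F = rank_sum I u v" "F \<in> BH" "norm F \<le> 1" "finite_rank F"
proof -
  have scale: "rank_sum I u v (c *\<^sub>C x) = c *\<^sub>C rank_sum I u v x" for c x
    by (simp add: rank_sum_def cinner_scaleC_left cvec.scale_sum_right)
  have "bounded_linear (rank_sum I u v)"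
  proof
    show "rank_sum I u v (x + y) = rank_sum I u v x + rank_sum I u v y" for x y
      by (simp add: rank_sum_def cinner_add_left scaleC_add_left sum.distrib)
    show "rank_sum I u v (r *\<^sub>R x) = r *\<^sub>R rank_sum I u v x" for r x
      using scale[of "complex_of_real r" x] by (simp add: scaleC_of_real)
    show "\<exists>K. \<forall>x. norm (rank_sum I u v x) \<le> norm x * K"
      using norm_rank_sum_le[OF assms] by (intro exI[of _ 1]) simp
  qed
  then obtain F where F: "blinfun_apply F = rank_sum I u v"
    by (metis bounded_linear_Blinfun_apply)
  show thesis
  proof (rule that[OF F])
    show "F \<in> BH" by (simp add: BH_def F scale)
    show "norm F \<le> 1"
      using norm_rank_sum_le[OF assms] by (intro norm_blinfun_bound) (simp_all add: F)
    have "rank_sum I u v x \<in> cvec.span (u ` I)" for x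
      unfolding rank_sum_def
      by (intro cvec.span_sum cvec.span_scale) (simp add: cvec.span_base)
    then have "range F \<subseteq> cvec.span (u ` I)"
      by (auto simp: F)
    then show "finite_rank F"
      using assms(1) unfolding finite_rank_def by blast
  qed
qed

text \<open>
  For a contraction, closeness of \<open>\<langle>Fy, y\<rangle>\<close> to \<open>\<parallel>y\<parallel>\<^sup>2\<close> already forces \<open>Fy\<close> to be close to \<open>y\<close>; so
  only a single number has to be estimated for the block shift below.
\<close>

lemma contraction_defect:
  assumes "norm a \<le> norm y"
  shows "(norm (a - y))\<^sup>2 \<le> 2 * ((norm y)\<^sup>2 - Re (cinner a y))"
proof -
  have "(norm (a - y))\<^sup>2 = (norm a)\<^sup>2 + (norm y)\<^sup>2 - 2 * inner a y"
    unfolding power2_norm_eq_inner by (simp add: inner_simps inner_commute)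
  moreover have "(norm a)\<^sup>2 \<le> (norm y)\<^sup>2" using assms by (rule power_mono) simp
  ultimately show ?thesis by (simp add: Re_cinner)
qed

context maximal_nest
begin

section \<open>Approximation on one cyclic subspace\<close>

definition cyclic_set :: "'h \<Rightarrow> 'h set"
  where "cyclic_set z = (\<lambda>M. proj M z) ` \<N>"

text \<open>
  The data of a finite-rank contraction that lives on the cyclic subspace of \<open>z\<close>.  The fifth clause
  says that each rank-one term separately leaves the nest invariant.  The indices are natural
  numbers only to make frames for different generators uniform.
\<close>

definition approximating_frame ::
    "'h \<Rightarrow> real \<Rightarrow> nat set \<Rightarrow> (nat \<Rightarrow> 'h) \<Rightarrow> (nat \<Rightarrow> 'h) \<Rightarrow> bool"
  where "approximating_frame z \<epsilon> I u v \<longleftrightarrow>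
    finite I \<and> orthonormal I u \<and> orthonormal I v \<and>
    (\<forall>i\<in>I. u i \<in> cvec.span (cyclic_set z) \<and> v i \<in> cvec.span (cyclic_set z)) \<and>
    (\<forall>i\<in>I. \<forall>M\<in>\<N>. u i \<in> M \<or> (\<forall>m\<in>M. cinner m (v i) = 0)) \<and>
    (\<forall>M\<in>\<N>. norm (rank_sum I u v (proj M z) - proj M z) \<le> \<epsilon>)"

lemma proj_mem_span: "M \<in> \<N> \<Longrightarrow> proj M z \<in> cvec.span (cyclic_set z)"
  by (auto simp: cyclic_set_def intro: cvec.span_base)

lemma atomic_approximating_frame:
  assumes z: "z \<noteq> 0" "atomic_vector z" and "0 \<le> \<epsilon>"
  obtains I u v where "approximating_frame z \<epsilon> I u v"
proof -
  define e where "e = complex_of_real (1 / norm z) *\<^sub>C z"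
  have "norm e = 1"
    using z by (simp add: e_def norm_scaleC norm_divide)
  then have ee: "cinner e e = 1"
    by (simp add: cinner_self)
  have "z \<in> cvec.span (cyclic_set z)"
    using proj_mem_span[OF UNIV_mem, of z] by simp
  then have span: "e \<in> cvec.span (cyclic_set z)"
    unfolding e_def by (rule cvec.span_scale)
  have tri: "e \<in> M \<or> (\<forall>m\<in>M. cinner m e = 0)" if "M \<in> \<N>" for M
    using z(2) that closed_csubspace[OF that]
    unfolding atomic_vector_def e_def by (auto simp: cinner_scaleC_right closed_csubspace_intros)
  have fixed: "cinner (proj M z) e *\<^sub>C e = proj M z" if M: "M \<in> \<N>" for M
  proof (cases "z \<in> M")
    case True
    then show ?thesis
      using z by (simp add: proj_id[OF closed_csubspace[OF M]] e_def cinner_scaleC_right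
        scaleC_scaleC cinner_self power2_eq_square)
  next
    case False
    then have "\<forall>m\<in>M. cinner m z = 0" using z(2) M unfolding atomic_vector_def by blast
    then have "proj M z = 0"
      using proj_in[OF closed_csubspace[OF M], of z] cinner_proj_right[OF closed_csubspace[OF M]]
      by (metis cinner_self_eq_zero)
    then show ?thesis by simp
  qed
  have "approximating_frame z \<epsilon> {0} (\<lambda>_. e) (\<lambda>_. e)"
    using assms(3) ee span tri fixed
    by (auto simp: approximating_frame_def orthonormal_def rank_sum_def)
  then show thesis by (rule that)
qed

text \<open>
  The Gram matrix of the vectors \<open>P\<^sub>M z\<close> depends on their norms alone, so every computation in the
  cyclic subspace becomes one with minima of real numbers.
\<close>

lemma cinner_proj_proj:
  assumes "M \<in> \<N>" "N \<in> \<N>"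
  shows "cinner (proj M z) (proj N z)
    = complex_of_real (min ((norm (proj M z))\<^sup>2) ((norm (proj N z))\<^sup>2))"
proof -
  have *: "cinner (proj M z) (proj N z) = complex_of_real ((norm (proj M z))\<^sup>2)
      \<and> cinner (proj N z) (proj M z) = complex_of_real ((norm (proj M z))\<^sup>2)
      \<and> (norm (proj M z))\<^sup>2 \<le> (norm (proj N z))\<^sup>2"
    if "M \<in> \<N>" "N \<in> \<N>" "M \<subseteq> N" for M N
    using that cinner_proj_nested[OF closed_csubspace closed_csubspace, of M N]
      cinner_proj_self[OF closed_csubspace, of M] proj_selfadjoint[OF closed_csubspace, of M]
      norm_proj_mono[OF closed_csubspace closed_csubspace, of M N]
    by (simp add: power_mono)
  show ?thesis
    using chain[OF assms] *[OF assms] *[OF assms(2,1)] by (auto simp: min_absorb1 min_absorb2)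
qed

text \<open>
  The operator is the shift \<open>e (Suc i) \<mapsto> e i\<close> of \<open>k\<close> blocks of squared norm \<open>t = c / k\<close>.  It
  preserves a member \<open>M\<close> of the nest because \<open>M\<close> either contains the space up to the end of block
  \<open>i\<close>, and with it \<open>e i\<close>, or is contained in that space and is orthogonal to \<open>e (Suc i)\<close>.  On
  \<open>P\<^sub>M z\<close> it loses at most the weight of one block in the inner product.
\<close>

lemma diffuse_approximating_frame:
  assumes z: "z \<noteq> 0" "diffuse_vector z" and \<epsilon>: "0 < \<epsilon>"
  obtains I u v where "approximating_frame z \<epsilon> I u v"
proof -
  define c where "c = (norm z)\<^sup>2"
  \<comment> \<open>With this \<open>k\<close> the bound \<open>2 * t\<close> for the squared error is at most \<open>\<epsilon>\<^sup>2\<close>; \<open>Suc\<close> keeps it positive.\<close>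
  define k where "k = Suc (nat \<lceil>2 * c / \<epsilon>\<^sup>2\<rceil>)"
  define t where "t = c / real k"
  have "c > 0" using z by (simp add: c_def)
  have "real k > 0" by (simp add: k_def del: of_nat_Suc)
  with \<open>c > 0\<close> have "t > 0" by (simp add: t_def)
  have "2 * c / \<epsilon>\<^sup>2 \<le> real k" unfolding k_def by linarith
  then have t_le: "2 * t \<le> \<epsilon>\<^sup>2"
    using \<epsilon> \<open>real k > 0\<close> by (simp add: t_def field_simps)
  have tk: "t * real k = c" using \<open>real k > 0\<close> by (simp add: t_def)
  have "\<exists>M\<in>\<N>. (norm (proj M z))\<^sup>2 = t * real i" if "i \<le> k" for i
  proof -
    have "t * real i \<le> t * real k" using that \<open>t > 0\<close> by simp
    then have "t * real i \<in> {0..(norm z)\<^sup>2}" using \<open>t > 0\<close> tk by (simp add: c_def)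
    with z(2) show ?thesis unfolding diffuse_vector_def by blast
  qed
  then obtain N where N: "\<And>i. i \<le> k \<Longrightarrow> N i \<in> \<N>"
    and f: "\<And>i. i \<le> k \<Longrightarrow> (norm (proj (N i) z))\<^sup>2 = t * real i"
    by metis
  have cs: "closed_csubspace (N i)" if "i \<le> k" for i
    using closed_csubspace[OF N[OF that]] .
  have N_mono: "N i \<subseteq> N (Suc i)" if "Suc i \<le> k" for i
  proof (rule ccontr)
    assume "\<not> N i \<subseteq> N (Suc i)"
    then have "N (Suc i) \<subseteq> N i" using chain N that by (meson Suc_leD)
    then have "(norm (proj (N (Suc i)) z))\<^sup>2 \<le> (norm (proj (N i) z))\<^sup>2"
      using norm_proj_mono[OF cs cs] that by (simp add: power_mono)
    with f[of i] f[of "Suc i"] that \<open>t > 0\<close> show False by simp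
  qed
  define d where "d i = proj (N (Suc i)) z - proj (N i) z" for i
  define e where "e i = complex_of_real (1 / sqrt t) *\<^sub>C d i" for i
  have dd: "cinner (d i) (d j) = (if i = j then complex_of_real t else 0)"
    if "i < k" "j < k" for i j
  proof -
    have m: "min (t * a) (t * b) = t * min a b" for a b :: real
      using \<open>t > 0\<close> by (simp add: min_def)
    have "cinner (d i) (d j) = complex_of_real (t *
       (min (real (Suc i)) (real (Suc j)) - min (real (Suc i)) (real j)
        - min (real i) (real (Suc j)) + min (real i) (real j)))"
      using that by (simp add: d_def cinner_simps cinner_proj_proj N f m del: of_nat_Suc)
        (simp add: algebra_simps)
    also have "min (real (Suc i)) (real (Suc j)) - min (real (Suc i)) (real j)
        - min (real i) (real (Suc j)) + min (real i) (real j) = (if i = j then 1 else 0)"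
      by (auto simp: min_def)
    finally show ?thesis by simp
  qed
  have sq: "complex_of_real (sqrt t) * complex_of_real (sqrt t) = complex_of_real t"
    using \<open>t > 0\<close> by (simp flip: of_real_mult)
  have ee: "cinner (e i) (e j) = (if i = j then 1 else 0)" if "i < k" "j < k" for i j
    using dd[OF that] \<open>t > 0\<close>
    by (simp add: e_def cinner_scaleC_left cinner_scaleC_right sq)
  have span: "e i \<in> cvec.span (cyclic_set z)" if "i < k" for i
    using that unfolding e_def d_def
    by (intro cvec.span_scale cvec.span_diff proj_mem_span N) auto
  let ?I = "{..<k - 1}" and ?v = "\<lambda>i. e (Suc i)"
  have on: "orthonormal ?I e" "orthonormal ?I ?v"
    using ee by (auto simp: orthonormal_def)
  have tri: "e i \<in> M \<or> (\<forall>m\<in>M. cinner m (e (Suc i)) = 0)" if i: "i < k - 1" and M: "M \<in> \<N>" for i M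
  proof -
    have i: "i \<le> k" "Suc i \<le> k" "Suc (Suc i) \<le> k" using i by auto
    consider "N (Suc i) \<subseteq> M" | "M \<subseteq> N (Suc i)" using chain[OF N[OF i(2)] M] by blast
    then show ?thesis
    proof cases
      case 1
      have "d i \<in> N (Suc i)"
        unfolding d_def using N_mono[OF i(2)] proj_in[OF cs[OF i(2)]] proj_in[OF cs[OF i(1)]]
        by (meson closed_csubspace_intros(3) cs i(2) subsetD)
      then have "e i \<in> N (Suc i)"
        unfolding e_def by (rule closed_csubspace_intros(4)[OF cs[OF i(2)]])
      with 1 show ?thesis by blast
    next
      case 2
      have "cinner m (e (Suc i)) = 0" if "m \<in> M" for m
      proof -
        have "m \<in> N (Suc i)" "m \<in> N (Suc (Suc i))" using that 2 N_mono[OF i(3)] by auto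
        then show ?thesis
          by (simp add: e_def d_def cinner_scaleC_right cinner_diff_right
            cinner_proj_right[OF cs[OF i(2)]] cinner_proj_right[OF cs[OF i(3)]])
      qed
      then show ?thesis by blast
    qed
  qed
  have approx: "norm (rank_sum ?I e ?v (proj M z) - proj M z) \<le> \<epsilon>" if M: "M \<in> \<N>" for M
  proof -
    let ?y = "proj M z"
    define s where "s = (norm ?y)\<^sup>2"
    define m where "m j = min s (t * real j)" for j
    define a where "a j = m (Suc j) - m j" for j
    have "s \<le> c"
      unfolding s_def c_def by (intro power_mono norm_proj_le closed_csubspace M) simp
    have yd: "cinner ?y (d j) = complex_of_real (a j)" "cinner (d j) ?y = complex_of_real (a j)"
      if "j < k" for j
      using that M N[of j] N[of "Suc j"] f[of j] f[of "Suc j"]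
      by (simp_all add: d_def a_def m_def s_def cinner_simps cinner_proj_proj min.commute
        del: of_nat_Suc)
    \<comment> \<open>At most one block is cut by \<open>M\<close>, and every block before it has full weight \<open>t\<close>; so the
      products below collapse to a telescoping sum.\<close>
    have aa: "a (Suc i) * a i = t * a (Suc i)" for i
      using \<open>t > 0\<close> by (auto simp: a_def m_def min_def algebra_simps)
    have "cinner (rank_sum ?I e ?v ?y) ?y = (\<Sum>i\<in>?I. complex_of_real (a (Suc i)))"
    proof -
      have "cinner ?y (e (Suc i)) * cinner (e i) ?y = complex_of_real (a (Suc i))"
        if "i \<in> ?I" for i
      proof -
        have "cinner ?y (e (Suc i)) * cinner (e i) ?y
            = complex_of_real (a (Suc i) * a i) / complex_of_real t"
          using that by (simp add: e_def cinner_scaleC_left cinner_scaleC_right yd sq)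
        then show ?thesis using \<open>t > 0\<close> by (simp add: aa)
      qed
      then show ?thesis
        by (simp add: rank_sum_def cinner_sum_left cinner_scaleC_left)
    qed
    then have "Re (cinner (rank_sum ?I e ?v ?y) ?y) = (\<Sum>i\<in>?I. a (Suc i))"
      by simp
    also have "\<dots> = m k - m 1"
      using sum_lessThan_telescope[of "\<lambda>i. m (Suc i)" "k - 1"] by (simp add: a_def k_def)
    also have "\<dots> \<ge> s - t"
      using \<open>s \<le> c\<close> tk by (simp add: m_def)
    finally have "s - Re (cinner (rank_sum ?I e ?v ?y) ?y) \<le> t" by simp
    then have "2 * (s - Re (cinner (rank_sum ?I e ?v ?y) ?y)) \<le> \<epsilon>\<^sup>2"
      using t_le by simp
    moreover have "(norm (rank_sum ?I e ?v ?y - ?y))\<^sup>2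
        \<le> 2 * (s - Re (cinner (rank_sum ?I e ?v ?y) ?y))"
      unfolding s_def by (rule contraction_defect) (rule norm_rank_sum_le[OF _ on], simp)
    ultimately have "(norm (rank_sum ?I e ?v ?y - ?y))\<^sup>2 \<le> \<epsilon>\<^sup>2"
      by (rule order_trans[rotated])
    then show ?thesis using \<epsilon> by (simp add: power2_le_iff_abs_le)
  qed
  have "approximating_frame z \<epsilon> ?I e ?v"
    unfolding approximating_frame_def using on span tri approx by auto
  then show thesis by (rule that)
qed

section \<open>Orthogonal families of cyclic subspaces\<close>

definition cyclic_family :: "'h set \<Rightarrow> bool"
  where "cyclic_family Z \<longleftrightarrow>
    (\<forall>z\<in>Z. z \<noteq> 0 \<and> (atomic_vector z \<or> diffuse_vector z)) \<and>
    (\<forall>z\<in>Z. \<forall>w\<in>Z. z \<noteq> w \<longrightarrow> (\<forall>M\<in>\<N>. cinner z (proj M w) = 0))"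

lemma cyclic_family_subset: "cyclic_family Z \<Longrightarrow> Y \<subseteq> Z \<Longrightarrow> cyclic_family Y"
  unfolding cyclic_family_def by (simp add: subset_iff)

lemma cyclic_spans_orthogonal:
  assumes "\<And>M. M \<in> \<N> \<Longrightarrow> cinner z (proj M w) = 0"
    and x: "x \<in> cvec.span (cyclic_set z)" and y: "y \<in> cvec.span (cyclic_set w)"
  shows "cinner x y = 0"
proof -
  have sub: "cvec.subspace {x. \<forall>y\<in>S. cinner x y = 0}" for S :: "'h set"
    using closed_csubspace_orthogonal unfolding closed_csubspace_def by blast
  have gen: "cinner (proj M z) (proj N w) = 0" if "M \<in> \<N>" "N \<in> \<N>" for M N
    using chain[OF that]
  proof
    assume "M \<subseteq> N"
    then show ?thesis
      using cinner_proj_nested(1)[OF closed_csubspace closed_csubspace, OF that]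
        proj_selfadjoint[OF closed_csubspace, OF that(1)] assms(1)[OF that(1)] by simp
  next
    assume "N \<subseteq> M"
    then show ?thesis
      using cinner_proj_nested(2)[OF closed_csubspace closed_csubspace, OF that(2,1)]
        assms(1)[OF that(2)] by simp
  qed
  have "cvec.span (cyclic_set z) \<subseteq> {x. \<forall>y\<in>cyclic_set w. cinner x y = 0}"
    by (rule cvec.span_minimal[OF _ sub]) (auto simp: cyclic_set_def gen)
  then have "cyclic_set w \<subseteq> {y. \<forall>x\<in>{x}. cinner y x = 0}"
    using x by (auto simp: cinner_eq_zero_commute[of _ x])
  then have "cvec.span (cyclic_set w) \<subseteq> {y. \<forall>x\<in>{x}. cinner y x = 0}"
    by (rule cvec.span_minimal[OF _ sub])
  then show ?thesis using y by (auto simp: cinner_eq_zero_commute[of _ x])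
qed

text \<open>
  Take a maximal family.  A nonzero vector orthogonal to all its cyclic subspaces is diffuse or has
  a nonzero atomic part, which stays orthogonal to them; either way the family could be enlarged.
\<close>

lemma total_cyclic_family:
  obtains Z where "cyclic_family Z" "closure (cvec.span (\<Union>z\<in>Z. cyclic_set z)) = UNIV"
proof -
  have "\<exists>Z\<in>Collect cyclic_family. \<forall>X\<in>Collect cyclic_family. Z \<subseteq> X \<longrightarrow> X = Z"
  proof (rule subset_Zorn_nonempty)
    have "cyclic_family {}" by (simp add: cyclic_family_def)
    then show "Collect cyclic_family \<noteq> {}" by blast
    fix \<K> assume "\<K> \<noteq> {}" "subset.chain (Collect cyclic_family) \<K>"
    then have fam: "\<And>X. X \<in> \<K> \<Longrightarrow> cyclic_family X"
      and ch: "\<And>X Y. X \<in> \<K> \<Longrightarrow> Y \<in> \<K> \<Longrightarrow> X \<subseteq> Y \<or> Y \<subseteq> X"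
      by (auto simp: subset_chain_def)
    have "cinner z (proj M w) = 0"
      if zw: "z \<in> \<Union>\<K>" "w \<in> \<Union>\<K>" "z \<noteq> w" "M \<in> \<N>" for z w M
    proof -
      obtain X Y where "X \<in> \<K>" "z \<in> X" "Y \<in> \<K>" "w \<in> Y" using zw by blast
      then obtain W where W: "W \<in> \<K>" "z \<in> W" "w \<in> W" using ch[of X Y] by blast
      show ?thesis using fam[OF W(1)] W(2,3) zw(3,4) unfolding cyclic_family_def by simp
    qed
    moreover have "z \<noteq> 0 \<and> (atomic_vector z \<or> diffuse_vector z)" if "z \<in> \<Union>\<K>" for z
      using that fam unfolding cyclic_family_def by auto
    ultimately have "cyclic_family (\<Union>\<K>)" unfolding cyclic_family_def by simp
    then show "\<Union>\<K> \<in> Collect cyclic_family" by simp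
  qed
  then obtain Z where Z: "cyclic_family Z" and max: "\<And>X. cyclic_family X \<Longrightarrow> Z \<subseteq> X \<Longrightarrow> X = Z"
    by auto
  define K where "K = closure (cvec.span (\<Union>z\<in>Z. cyclic_set z))"
  have K: "closed_csubspace K"
    unfolding K_def by (intro closed_csubspace_closure cvec.subspace_span)
  have in_K: "proj M z \<in> K" if zM: "z \<in> Z" "M \<in> \<N>" for z M
  proof -
    have "proj M z \<in> (\<Union>z\<in>Z. cyclic_set z)" using zM by (auto simp: cyclic_set_def)
    then have "proj M z \<in> cvec.span (\<Union>z\<in>Z. cyclic_set z)" by (rule cvec.span_base)
    then show ?thesis unfolding K_def using closure_subset by blast
  qed
  have zero: "y = 0" if y: "\<And>x. x \<in> K \<Longrightarrow> cinner y x = 0" for y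
  proof (rule ccontr)
    assume "y \<noteq> 0"
    have orth: "cinner (proj N y) (proj M z) = 0" if "z \<in> Z" "M \<in> \<N>" "N \<in> \<N>" for z M N
      by (rule cyclic_spans_orthogonal[of y z])
        (use that y in_K in \<open>auto intro: proj_mem_span\<close>)
    have contra: False
      if w: "w \<noteq> 0" "atomic_vector w \<or> diffuse_vector w"
        and wK: "\<And>z M. z \<in> Z \<Longrightarrow> M \<in> \<N> \<Longrightarrow> cinner w (proj M z) = 0" for w
    proof -
      have wK': "cinner z (proj M w) = 0" if "z \<in> Z" "M \<in> \<N>" for z M
        using wK[OF that] proj_selfadjoint[OF closed_csubspace[OF that(2)]]
        by (metis cinner_eq_zero_commute)
      have "cyclic_family (insert w Z)"
        using Z w wK wK' unfolding cyclic_family_def by auto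
      then have "w \<in> Z" using max by blast
      then have "cinner w w = 0" using wK[OF _ UNIV_mem] by simp
      with w show False by simp
    qed
    show False
    proof (cases "diffuse_vector y")
      case True
      show False by (rule contra[of y]) (use True \<open>y \<noteq> 0\<close> y in_K in auto)
    next
      case False
      then obtain M N where "M \<in> \<N>" "N \<in> \<N>" "proj N y - proj M y \<noteq> 0"
          "atomic_vector (proj N y - proj M y)"
        by (rule diffuse_or_atomic_part)
      then show False
        by (intro contra[of "proj N y - proj M y"]) (auto simp: cinner_diff_left orth)
    qed
  qed
  have "x - proj K x = 0" for x by (rule zero) (rule proj_residual[OF K])
  then have "x \<in> K" for x using proj_in[OF K, of x] by simp
  then have "K = UNIV" by auto
  with Z show thesis unfolding K_def by (rule that)
qed

section \<open>Density of finite-rank contractions in a nest algebra\<close>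

definition finite_rank_contraction :: "('h \<Rightarrow>\<^sub>L 'h) \<Rightarrow> bool"
  where "finite_rank_contraction F \<longleftrightarrow> F \<in> BH \<and> norm F \<le> 1 \<and> finite_rank F \<and>
    (\<forall>M\<in>\<N>. \<forall>x\<in>M. blinfun_apply F x \<in> M)"

text \<open>
  Frames of different generators lie in orthogonal subspaces, so together they are again
  orthonormal, and on each cyclic subspace only its own frame acts.
\<close>

lemma finite_rank_contraction_near_identity:
  assumes Z: "cyclic_family Z" "finite Z" and "0 < \<epsilon>"
  shows "\<exists>F. finite_rank_contraction F \<and>
    (\<forall>z\<in>Z. \<forall>M\<in>\<N>. norm (blinfun_apply F (proj M z) - proj M z) \<le> \<epsilon>)"
proof -
  have "\<exists>I u v. approximating_frame z \<epsilon> I u v" if "z \<in> Z" for z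
    using that Z(1) assms(3) unfolding cyclic_family_def
    by (meson atomic_approximating_frame diffuse_approximating_frame less_imp_le)
  then obtain I u v where fr: "\<And>z. z \<in> Z \<Longrightarrow> approximating_frame z \<epsilon> (I z) (u z) (v z)"
    by metis
  have fin: "finite (I z)" and on: "orthonormal (I z) (u z)" "orthonormal (I z) (v z)"
    and span: "\<And>i. i \<in> I z \<Longrightarrow> u z i \<in> cvec.span (cyclic_set z)"
      "\<And>i. i \<in> I z \<Longrightarrow> v z i \<in> cvec.span (cyclic_set z)"
    and tri: "\<And>i M m. i \<in> I z \<Longrightarrow> M \<in> \<N> \<Longrightarrow> m \<in> M \<Longrightarrow> u z i \<in> M \<or> cinner m (v z i) = 0"
    and approx: "\<And>M. M \<in> \<N> \<Longrightarrow> norm (rank_sum (I z) (u z) (v z) (proj M z) - proj M z) \<le> \<epsilon>"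
    if "z \<in> Z" for z
    using fr[OF that] unfolding approximating_frame_def by blast+
  define J where "J = Sigma Z I"
  define U V where "U = case_prod u" and "V = case_prod v"
  have finJ: "finite J"
    unfolding J_def using Z(2) fin by (rule finite_SigmaI)
  have cross: "cinner x y = 0"
    if zw: "z \<in> Z" "w \<in> Z" "z \<noteq> w"
      and xy: "x \<in> cvec.span (cyclic_set z)" "y \<in> cvec.span (cyclic_set w)"
    for z w x y
  proof (rule cyclic_spans_orthogonal[OF _ xy])
    show "cinner z (proj M w) = 0" if "M \<in> \<N>" for M
      using Z(1) zw that unfolding cyclic_family_def by simp
  qed
  have onJ: "orthonormal J (case_prod e)"
    if "\<And>z. z \<in> Z \<Longrightarrow> orthonormal (I z) (e z)"
      and "\<And>z i. z \<in> Z \<Longrightarrow> i \<in> I z \<Longrightarrow> e z i \<in> cvec.span (cyclic_set z)"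
    for e :: "'h \<Rightarrow> nat \<Rightarrow> 'h"
    unfolding orthonormal_def
  proof (intro ballI)
    fix a b assume "a \<in> J" "b \<in> J"
    then obtain z i w j where ab: "a = (z, i)" "b = (w, j)" "z \<in> Z" "i \<in> I z" "w \<in> Z" "j \<in> I w"
      unfolding J_def by blast
    show "cinner (case_prod e a) (case_prod e b) = (if a = b then 1 else 0)"
    proof (cases "z = w")
      case True
      then show ?thesis using that(1)[OF ab(3)] ab by (simp add: orthonormal_def)
    next
      case False
      then show ?thesis using cross[OF ab(3,5) False that(2) that(2)] ab by simp
    qed
  qed
  have onU: "orthonormal J U" and onV: "orthonormal J V"
    unfolding U_def V_def by (intro onJ on span; assumption)+
  obtain F where F: "blinfun_apply F = rank_sum J U V" "F \<in> BH" "norm F \<le> 1" "finite_rank F"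
    by (rule rank_sum_blinfun[OF finJ onU onV])
  have split: "rank_sum J U V x = (\<Sum>z\<in>Z. rank_sum (I z) (u z) (v z) x)" for x
    unfolding rank_sum_def J_def U_def V_def using Z(2) fin
    by (simp add: sum.Sigma case_prod_beta)
  have "rank_sum J U V x \<in> M" if M: "M \<in> \<N>" "x \<in> M" for x M
  proof -
    have "cinner x (V a) *\<^sub>C U a \<in> M" if a: "a \<in> J" for a
    proof -
      obtain z i where zi: "a = (z, i)" "z \<in> Z" "i \<in> I z" using a by (auto simp: J_def)
      then have "u z i \<in> M \<or> cinner x (v z i) = 0"
        using tri[OF zi(2,3) M] by blast
      then show ?thesis
        using closed_csubspace[OF M(1)] by (auto simp: zi U_def V_def closed_csubspace_intros)
    qed
    then show ?thesis
      using closed_csubspace[OF M(1)] unfolding rank_sum_def closed_csubspace_def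
      by (auto intro: cvec.subspace_sum)
  qed
  then have "finite_rank_contraction F"
    using F by (simp add: finite_rank_contraction_def)
  moreover have "norm (blinfun_apply F (proj M z) - proj M z) \<le> \<epsilon>" if zM: "z \<in> Z" "M \<in> \<N>" for z M
  proof -
    have "rank_sum (I w) (u w) (v w) (proj M z) = 0" if "w \<in> Z - {z}" for w
      using that zM(1) cross[of z w, OF _ _ _ proj_mem_span[OF zM(2)] span(2)]
      by (auto simp: rank_sum_def intro!: sum.neutral)
    then have "rank_sum J U V (proj M z) = rank_sum (I z) (u z) (v z) (proj M z)"
      unfolding split using Z(2) zM(1) by (simp add: sum.remove[of Z z])
    then show ?thesis using approx[OF zM] by (simp add: F)
  qed
  ultimately show ?thesis by blast
qed

text \<open>
  The net is indexed by finite subsets of a total family of generators and by an accuracy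
  \<open>1 / (n + 1)\<close>.  Strong convergence holds on the vectors \<open>P\<^sub>M z\<close>, hence on their linear span, and
  uniform boundedness carries it over to the closure of the span, which is the whole space.
\<close>

lemma finite_rank_approximate_identity:
  obtains F :: "'h set \<times> nat \<Rightarrow> 'h \<Rightarrow>\<^sub>L 'h" and \<Phi>
  where "\<Phi> \<noteq> bot" "\<forall>i. finite_rank_contraction (F i)"
    "\<forall>x. ((\<lambda>i. blinfun_apply (F i) x) \<longlongrightarrow> x) \<Phi>"
proof -
  obtain Z where Z: "cyclic_family Z" "closure (cvec.span (\<Union>z\<in>Z. cyclic_set z)) = UNIV"
    by (rule total_cyclic_family)
  \<comment> \<open>Index sets outside the family get the zero operator, so that the net is defined everywhere.\<close>
  have "\<exists>F. finite_rank_contraction F \<and> (Y \<subseteq> Z \<and> finite Y \<longrightarrow> (\<forall>z\<in>Y. \<forall>M\<in>\<N>.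
    norm (blinfun_apply F (proj M z) - proj M z) \<le> inverse (real (Suc n))))" for Y n
  proof (cases "Y \<subseteq> Z \<and> finite Y")
    case True
    then have "cyclic_family Y" "finite Y" "0 < inverse (real (Suc n))"
      using cyclic_family_subset[OF Z(1)] by simp_all
    then show ?thesis
      using finite_rank_contraction_near_identity[of Y "inverse (real (Suc n))"] by blast
  next
    case False
    have "finite_rank_contraction 0"
      using closed_csubspace by (auto simp: finite_rank_contraction_def BH_def finite_rank_def
        closed_csubspace_intros intro!: exI[of _ "{}"])
    with False show ?thesis by blast
  qed
  then obtain G where G: "\<And>Y n. finite_rank_contraction (G Y n)"
    and G_le: "\<And>Y n z M. Y \<subseteq> Z \<Longrightarrow> finite Y \<Longrightarrow> z \<in> Y \<Longrightarrow> M \<in> \<N> \<Longrightarrow>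
      norm (blinfun_apply (G Y n) (proj M z) - proj M z) \<le> inverse (real (Suc n))"
    by metis
  define F where "F = case_prod G"
  define \<Phi> where "\<Phi> = finite_subsets_at_top Z \<times>\<^sub>F sequentially"
  have F: "finite_rank_contraction (F i)" for i by (simp add: F_def G split: prod.split)
  define L where "L = {x. ((\<lambda>i. blinfun_apply (F i) x) \<longlongrightarrow> x) \<Phi>}"
  have gen: "proj M z \<in> L" if "z \<in> Z" "M \<in> \<N>" for z M
  proof -
    have "\<forall>\<^sub>F Y in finite_subsets_at_top Z. Y \<subseteq> Z \<and> finite Y \<and> z \<in> Y"
      using \<open>z \<in> Z\<close> unfolding eventually_finite_subsets_at_top by (intro exI[of _ "{z}"]) auto
    then have "\<forall>\<^sub>F (Y, n) in \<Phi>. Y \<subseteq> Z \<and> finite Y \<and> z \<in> Y"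
      unfolding \<Phi>_def by (rule eventually_prod1[THEN iffD2, rotated]) simp
    then have "\<forall>\<^sub>F i in \<Phi>. norm (blinfun_apply (F i) (proj M z) - proj M z) \<le> inverse (real (Suc (snd i)))"
      by (rule eventually_mono) (auto simp: F_def G_le \<open>M \<in> \<N>\<close> simp del: of_nat_Suc)
    moreover have "((\<lambda>i. inverse (real (Suc (snd i)))) \<longlongrightarrow> 0) \<Phi>"
      unfolding \<Phi>_def by (rule filterlim_compose[OF LIMSEQ_inverse_real_of_nat filterlim_snd])
    ultimately have "((\<lambda>i. blinfun_apply (F i) (proj M z) - proj M z) \<longlongrightarrow> 0) \<Phi>"
      by (rule Lim_null_comparison)
    then show ?thesis by (simp add: L_def LIM_zero_iff)
  qed
  have "cvec.subspace L"
    using F by (auto simp: L_def cvec.subspace_def finite_rank_contraction_def BH_def blinfun.add_right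
      intro!: tendsto_add bounded_linear.tendsto[OF bounded_linear_scaleC])
  then have span: "cvec.span (\<Union>z\<in>Z. cyclic_set z) \<subseteq> L"
    by (intro cvec.span_minimal) (auto simp: cyclic_set_def gen)
  have "((\<lambda>i. blinfun_apply (F i) x) \<longlongrightarrow> x) \<Phi>" for x
  proof (rule tendstoI)
    fix e :: real assume "e > 0"
    have "x \<in> closure (cvec.span (\<Union>z\<in>Z. cyclic_set z))" using Z(2) by simp
    then obtain y where y: "y \<in> L" "dist y x < e / 3"
      using span \<open>e > 0\<close> unfolding closure_approachable by (meson divide_pos_pos subsetD zero_less_numeral)
    have "((\<lambda>i. blinfun_apply (F i) y) \<longlongrightarrow> y) \<Phi>" using y(1) by (simp add: L_def)
    then have "\<forall>\<^sub>F i in \<Phi>. dist (blinfun_apply (F i) y) y < e / 3"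
      by (rule tendstoD) (use \<open>e > 0\<close> in simp)
    then show "\<forall>\<^sub>F i in \<Phi>. dist (blinfun_apply (F i) x) x < e"
    proof (rule eventually_mono)
      fix i assume i: "dist (blinfun_apply (F i) y) y < e / 3"
      have "dist (blinfun_apply (F i) x) (blinfun_apply (F i) y) = norm (blinfun_apply (F i) (x - y))"
        by (simp add: dist_norm blinfun.diff_right)
      also have "\<dots> \<le> norm (F i) * norm (x - y)" by (rule norm_blinfun)
      also have "\<dots> \<le> 1 * norm (x - y)"
        using F by (intro mult_right_mono) (auto simp: finite_rank_contraction_def)
      finally have "dist (blinfun_apply (F i) x) (blinfun_apply (F i) y) \<le> dist y x"
        by (simp add: dist_norm norm_minus_commute)
      then show "dist (blinfun_apply (F i) x) x < e"
        using i y(2) dist_triangle[of "blinfun_apply (F i) x" x "blinfun_apply (F i) y"]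
          dist_triangle[of "blinfun_apply (F i) y" x y] by linarith
    qed
  qed
  moreover have "\<Phi> \<noteq> bot" by (simp add: \<Phi>_def prod_filter_eq_bot)
  ultimately show thesis using F that by blast
qed

end

section \<open>Partial isometries\<close>

lemma closed_csubspace_initial_space: "closed_csubspace (initial_space V)"
  using closed_csubspace_orthogonal[of "{y. blinfun_apply V y = 0}"]
  by (simp add: initial_space_def)

lemma closed_csubspace_kernel:
  assumes "V \<in> BH" shows "closed_csubspace {x. blinfun_apply V x = 0}"
proof -
  have "closed {x. blinfun_apply V x = 0}"
    by (intro closed_Collect_eq continuous_intros)
  then show ?thesis
    using assms by (auto simp: closed_csubspace_def cvec.subspace_def BH_def blinfun.add_right)
qed

lemma apply_proj_initial_space:
  assumes "V \<in> BH"
  shows "blinfun_apply V (proj (initial_space V) x) = blinfun_apply V x"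
proof -
  let ?K = "{x. blinfun_apply V x = 0}"
  note K = closed_csubspace_kernel[OF assms]
  have "proj (initial_space V) x = x - proj ?K x"
    using proj_orthogonal_complement[OF K, of x] by (simp add: initial_space_def)
  moreover have "blinfun_apply V (proj ?K x) = 0" using proj_in[OF K, of x] by simp
  ultimately show ?thesis by (simp add: blinfun.diff_right)
qed

lemma partial_isometry_cinner:
  assumes V: "partial_isometry V" and xy: "x \<in> initial_space V" "y \<in> initial_space V"
  shows "cinner (blinfun_apply V x) (blinfun_apply V y) = cinner x y"
proof -
  note sub = closed_csubspace_intros[OF closed_csubspace_initial_space[of V]]
  have iso: "inner (blinfun_apply V a) (blinfun_apply V b) = inner a b"
    if "a \<in> initial_space V" "b \<in> initial_space V" for a b
    using V that sub(2)[OF that]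
    by (simp add: dot_norm partial_isometry_def flip: blinfun.add_right)
  have "\<i> *\<^sub>C blinfun_apply V x = blinfun_apply V (\<i> *\<^sub>C x)"
    using V by (simp add: partial_isometry_def BH_def)
  then show ?thesis
    using iso[OF xy] iso[OF sub(4)[OF xy(1)] xy(2), of \<i>]
    by (intro complex_eqI) (simp_all add: Re_cinner Im_cinner)
qed

text \<open>
  A partial isometry preserves inner products on its initial space and annihilates the orthogonal
  complement, so \<open>\<langle>V z, V x\<rangle> = \<langle>P z, P x\<rangle>\<close> with \<open>P\<close> the projection onto the initial space.
\<close>

lemma init_proj_eq_proj:
  assumes V: "partial_isometry V"
  shows "blinfun_apply (init_proj V) x = proj (initial_space V) x"
proof (rule cinner_eqI)
  fix z
  have BH: "V \<in> BH" using V by (simp add: partial_isometry_def)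
  let ?P = "proj (initial_space V)"
  note cs = closed_csubspace_initial_space[of V]
  have "is_adjoint V (adj V)"
    unfolding adj_def by (rule theI'[OF ex1_adjoint[OF BH]])
  then have "cinner z (blinfun_apply (init_proj V) x)
      = cinner (blinfun_apply V z) (blinfun_apply V x)"
    by (simp add: is_adjoint_def init_proj_def)
  also have "\<dots> = cinner (blinfun_apply V (?P z)) (blinfun_apply V (?P x))"
    by (simp add: apply_proj_initial_space[OF BH])
  also have "\<dots> = cinner (?P z) (?P x)"
    by (intro partial_isometry_cinner V proj_in cs)
  also have "\<dots> = cinner z (?P x)"
    by (intro cinner_proj_left cs proj_in)
  finally show "cinner z (blinfun_apply (init_proj V) x) = cinner z (?P x)" .
qed

text \<open>
  If \<open>E \<le> F\<close> then \<open>F\<close> is isometric on the initial space of \<open>E\<close>; but \<open>F\<close> strictly shrinks every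
  vector that is not in its own initial space.
\<close>

lemma initial_space_mono:
  assumes E: "partial_isometry E" and F: "partial_isometry F" and le: "pi_le E F"
  shows "initial_space E \<subseteq> initial_space F"
proof
  fix x assume x: "x \<in> initial_space E"
  let ?p = "proj (initial_space F) x"
  note cs = closed_csubspace_initial_space[of F]
  have p: "?p \<in> initial_space F" by (rule proj_in[OF cs])
  have "norm x = norm (blinfun_apply F x)"
    using E le x by (simp add: partial_isometry_def pi_le_def)
  also have "\<dots> = norm (blinfun_apply F ?p)"
    using F by (simp add: apply_proj_initial_space partial_isometry_def)
  also have "\<dots> = norm ?p" using F p by (simp add: partial_isometry_def)
  finally have "(norm (x - ?p))\<^sup>2 = 0" by (simp add: norm_residual[OF cs])
  then show "x \<in> initial_space F" using p by simp
qed

section \<open>The strong operator topology\<close>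

lemma topspace_BH_SOT: "topspace BH_SOT = BH"
  by (simp add: BH_SOT_def strong_operator_topology_topspace)

lemma BH_SOT_closureI:
  assumes "\<Phi> \<noteq> bot" "T \<in> BH" "A \<subseteq> BH" "\<And>i. S i \<in> A"
    and lim: "\<And>x. ((\<lambda>i. blinfun_apply (S i) x) \<longlongrightarrow> blinfun_apply T x) \<Phi>"
  shows "T \<in> BH_SOT closure_of A"
  unfolding in_closure_of topspace_BH_SOT
proof (intro conjI allI impI)
  fix U assume U: "T \<in> U \<and> openin BH_SOT U"
  then obtain W where W: "open W" "U = blinfun_apply -` W \<inter> BH"
    unfolding BH_SOT_def strong_operator_topology_def openin_subtopology openin_pullback_topology
    by auto
  have "limitin (product_topology (\<lambda>_. euclidean) UNIV) (\<lambda>i. blinfun_apply (S i))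
      (blinfun_apply T) \<Phi>"
    using lim by (simp add: limitin_componentwise)
  then have "((\<lambda>i. blinfun_apply (S i)) \<longlongrightarrow> blinfun_apply T) \<Phi>"
    by (simp add: euclidean_product_topology)
  then have "\<forall>\<^sub>F i in \<Phi>. blinfun_apply (S i) \<in> W"
    using W U by (auto dest: topological_tendstoD)
  then obtain i where "blinfun_apply (S i) \<in> W"
    using eventually_happens' assms(1) by blast
  then have "S i \<in> U" using W assms(3,4) by auto
  then show "\<exists>y. y \<in> A \<and> y \<in> U" using assms(4) by blast
qed (rule assms(2))

lemma BH_SOT_closure_apply:
  assumes T: "T \<in> BH_SOT closure_of A" and C: "closed C"
    and A: "\<And>S. S \<in> A \<Longrightarrow> blinfun_apply S x \<in> C"
  shows "blinfun_apply T x \<in> C"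
proof -
  have "continuous_map BH_SOT euclidean (\<lambda>S. blinfun_apply S x)"
    unfolding BH_SOT_def
    by (intro continuous_map_from_subtopology strong_operator_topology_continuous_evaluation)
  then have "(\<lambda>S. blinfun_apply S x) ` (BH_SOT closure_of A)
      \<subseteq> euclidean closure_of ((\<lambda>S. blinfun_apply S x) ` A)"
    by (rule continuous_map_image_closure_subset)
  also have "\<dots> \<subseteq> C" using A C by (simp add: closure_minimal image_subset_iff)
  finally show ?thesis using T by blast
qed

text \<open>
  Membership in the unit ball is a conjunction of closed conditions on the values \<open>T x\<close> at single
  vectors.
\<close>

lemma BH_SOT_closure_unit_ball:
  assumes "A \<subseteq> closed_unit_ball (family_ops \<E>)"
  shows "BH_SOT closure_of A \<subseteq> closed_unit_ball (family_ops \<E>)"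
proof
  fix T assume T: "T \<in> BH_SOT closure_of A"
  then have "T \<in> BH"
    by (simp add: in_closure_of topspace_BH_SOT)
  moreover have "(id_blinfun - final_proj E) o\<^sub>L T o\<^sub>L init_proj E = 0" if E: "E \<in> \<E>" for E
  proof (rule blinfun_eqI)
    fix x
    let ?C = "{y. blinfun_apply (id_blinfun - final_proj E) y = 0}"
    have "blinfun_apply T (blinfun_apply (init_proj E) x) \<in> ?C"
    proof (rule BH_SOT_closure_apply[OF T])
      show "closed ?C" by (intro closed_Collect_eq continuous_intros)
      fix S assume "S \<in> A"
      then have "(id_blinfun - final_proj E) o\<^sub>L S o\<^sub>L init_proj E = 0"
        using assms E by (auto simp: closed_unit_ball_def family_ops_def)
      from arg_cong[OF this, of "\<lambda>R. blinfun_apply R x"]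
      show "blinfun_apply S (blinfun_apply (init_proj E) x) \<in> ?C" by simp
    qed
    then show "blinfun_apply ((id_blinfun - final_proj E) o\<^sub>L T o\<^sub>L init_proj E) x
        = blinfun_apply 0 x"
      by simp
  qed
  moreover have "norm T \<le> 1"
  proof (rule norm_blinfun_bound)
    fix x
    have "blinfun_apply T x \<in> {y. norm y \<le> norm x}"
    proof (rule BH_SOT_closure_apply[OF T])
      show "closed {y. norm y \<le> norm x}" by (intro closed_Collect_le continuous_intros)
      fix S assume "S \<in> A"
      then have "norm S \<le> 1" using assms by (auto simp: closed_unit_ball_def)
      then have "norm S * norm x \<le> 1 * norm x" by (rule mult_right_mono) simp
      then show "blinfun_apply S x \<in> {y. norm y \<le> norm x}"
        using norm_blinfun[of S x] by simp
    qed
    then show "norm (blinfun_apply T x) \<le> 1 * norm x" by simp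
  qed simp
  ultimately show "T \<in> closed_unit_ball (family_ops \<E>)"
    by (simp add: closed_unit_ball_def family_ops_def)
qed

section \<open>Multiplication by the approximate identity\<close>

lemma finite_rank_compose:
  assumes T: "T \<in> BH" and F: "finite_rank F"
  shows "finite_rank (T o\<^sub>L F)"
proof -
  obtain B where B: "finite B" "range (blinfun_apply F) \<subseteq> cvec.span B"
    using F unfolding finite_rank_def by blast
  have "cvec.subspace {y. blinfun_apply T y \<in> cvec.span (blinfun_apply T ` B)}"
    using T by (auto simp: cvec.subspace_def BH_def blinfun.add_right
      intro: cvec.span_zero cvec.span_add cvec.span_scale)
  then have "cvec.span B \<subseteq> {y. blinfun_apply T y \<in> cvec.span (blinfun_apply T ` B)}"
    by (rule cvec.span_minimal[rotated]) (auto intro: cvec.span_base)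
  with B have "range (blinfun_apply (T o\<^sub>L F)) \<subseteq> cvec.span (blinfun_apply T ` B)"
    by auto
  then show ?thesis using B(1) unfolding finite_rank_def by blast
qed

text \<open>
  The compatibility of \<open>T\<close> with \<open>E\<close> only concerns vectors in the initial space of \<open>E\<close>, and \<open>F\<close> does
  not lead out of it.
\<close>

lemma family_ops_compose:
  assumes \<E>: "\<And>E. E \<in> \<E> \<Longrightarrow> partial_isometry E" and T: "T \<in> family_ops \<E>" and F: "F \<in> BH"
    and inv: "\<And>E x. E \<in> \<E> \<Longrightarrow> x \<in> initial_space E \<Longrightarrow> blinfun_apply F x \<in> initial_space E"
  shows "T o\<^sub>L F \<in> family_ops \<E>"
proof -
  have "(id_blinfun - final_proj E) o\<^sub>L (T o\<^sub>L F) o\<^sub>L init_proj E = 0" if E: "E \<in> \<E>" for E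
  proof (rule blinfun_eqI)
    fix x
    let ?P = "blinfun_apply (init_proj E)" and ?R = "blinfun_apply (id_blinfun - final_proj E)"
    note P = init_proj_eq_proj[OF \<E>[OF E]] and cs = closed_csubspace_initial_space[of E]
    have "blinfun_apply F (?P x) \<in> initial_space E"
      unfolding P by (intro inv[OF E] proj_in cs)
    then have PF: "?P (blinfun_apply F (?P x)) = blinfun_apply F (?P x)"
      unfolding P by (rule proj_id[OF cs])
    have "(id_blinfun - final_proj E) o\<^sub>L T o\<^sub>L init_proj E = 0"
      using T E by (simp add: family_ops_def)
    from arg_cong[OF this, of "\<lambda>R. blinfun_apply R (blinfun_apply F (?P x))"]
    have "?R (blinfun_apply T (blinfun_apply F (?P x))) = 0"
      by (simp add: PF del: blinfun.diff_left)
    then show "blinfun_apply ((id_blinfun - final_proj E) o\<^sub>L (T o\<^sub>L F) o\<^sub>L init_proj E) x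
        = blinfun_apply 0 x"
      by simp
  qed
  moreover have "T o\<^sub>L F \<in> BH" using T F by (simp add: family_ops_def BH_def)
  ultimately show ?thesis by (simp add: family_ops_def)
qed

theorem theorem3p4:
  fixes \<E> :: "('h::complex_hilbert_space \<Rightarrow>\<^sub>L 'h) set"
  assumes "complete_family \<E>"
    and "totally_ordered \<E>"
    and "is_subalgebra (family_ops \<E>)"
  shows "BH_SOT closure_of {T \<in> closed_unit_ball (family_ops \<E>). finite_rank T}
    = closed_unit_ball (family_ops \<E>)"
proof
  let ?B = "closed_unit_ball (family_ops \<E>)"
  show "BH_SOT closure_of {T \<in> ?B. finite_rank T} \<subseteq> ?B"
    by (rule BH_SOT_closure_unit_ball) blast
  have pi: "partial_isometry E" if "E \<in> \<E>" for E
    using assms(1) that by (simp add: complete_family_def)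
  have ch: "initial_space E \<subseteq> initial_space F \<or> initial_space F \<subseteq> initial_space E"
    if "E \<in> \<E>" "F \<in> \<E>" for E F
    using assms(2) that initial_space_mono pi unfolding totally_ordered_def by metis
  have "closed_csubspace M" if "M \<in> initial_space ` \<E>" for M
    using that closed_csubspace_initial_space by auto
  moreover have "M \<subseteq> N \<or> N \<subseteq> M" if "M \<in> initial_space ` \<E>" "N \<in> initial_space ` \<E>" for M N
    using that ch by auto
  ultimately obtain \<N> where nest: "maximal_nest \<N>" and sub: "initial_space ` \<E> \<subseteq> \<N>"
    by (rule maximal_nest_extension)
  interpret maximal_nest \<N> by (fact nest)
  obtain F :: "'h set \<times> nat \<Rightarrow> 'h \<Rightarrow>\<^sub>L 'h" and \<Phi>
    where \<Phi>: "\<Phi> \<noteq> bot" and F: "\<forall>i. finite_rank_contraction (F i)"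
      and lim: "\<forall>x. ((\<lambda>i. blinfun_apply (F i) x) \<longlongrightarrow> x) \<Phi>"
    by (rule finite_rank_approximate_identity)
  show "?B \<subseteq> BH_SOT closure_of {T \<in> ?B. finite_rank T}"
  proof
    fix T assume T: "T \<in> ?B"
    then have BH: "T \<in> BH" "T \<in> family_ops \<E>" "norm T \<le> 1"
      by (auto simp: closed_unit_ball_def family_ops_def)
    show "T \<in> BH_SOT closure_of {T \<in> ?B. finite_rank T}"
    proof (rule BH_SOT_closureI[OF \<Phi> BH(1)])
      show "{T \<in> ?B. finite_rank T} \<subseteq> BH"
        by (auto simp: closed_unit_ball_def family_ops_def)
      show "T o\<^sub>L F i \<in> {T \<in> ?B. finite_rank T}" for i
      proof -
        have "T o\<^sub>L F i \<in> family_ops \<E>"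
          using F[rule_format, of i] sub
          by (intro family_ops_compose pi BH(2)) (auto simp: finite_rank_contraction_def)
        moreover have "norm (T o\<^sub>L F i) \<le> 1"
          using norm_blinfun_compose[of T "F i"] mult_le_one[OF BH(3) norm_ge_zero, of "F i"] F[rule_format, of i]
          by (simp add: finite_rank_contraction_def)
        moreover have "finite_rank (T o\<^sub>L F i)"
          using F[rule_format, of i] by (intro finite_rank_compose BH(1)) (simp add: finite_rank_contraction_def)
        ultimately show ?thesis by (simp add: closed_unit_ball_def)
      qed
      show "((\<lambda>i. blinfun_apply (T o\<^sub>L F i) x) \<longlongrightarrow> blinfun_apply T x) \<Phi>" for x
        by (simp add: blinfun.tendsto[OF tendsto_const lim[rule_format]])
    qed
  qed
qed

end
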